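(* For $i\in\{1,2\}$ let $\Sigma_i=Q_iD_iQ_i^\top\in\mathrm{Sym}^+(n,k)$ with $Q_i\in\mathrm{St}(n,k)$ and $D_i\in\mathrm{Sym}^+(k)$, and set $P_i:=\mathrm{Im}(\Sigma_i)=\mathrm{Span}(Q_i)$. Let $X:=Q_1D_1^{1/2}$, $Y:=Q_2D_2^{1/2}$, so that $\Sigma_1=XX^\top$ and $\Sigma_2=YY^\top$, and define $l:=\mathrm{rk}(X^\top Y)$. Let $\theta_1,\dots,\theta_k$ be the principal angles between $P_1$ and $P_2$ and $r:=\#\{i:\theta_i=\pi/2\}$. Then: (i) $k-l=r=\#\{i:\theta_i=\pi/2\}$; (ii) there is a bijection $O(r)\longleftrightarrow I_{BW}(\Sigma_1,\Sigma_2)$, where $$I_{BW}(\Sigma_1,\Sigma_2)=\{R\in O(k): X^\top YR\in\mathrm{Cov}(k)\}=\{R\in O(k): X^\top YR=(X^\top\Sigma_2X)^{1/2}\}.$$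
   Context: $\mathrm{St}(n,k)$ is the Stiefel manifold of real $n\times k$ matrices with orthonormal columns; $\mathrm{Sym}^+(k)$ the symmetric positive definite $k\times k$ matrices; $\mathrm{Cov}(k)$ the symmetric positive semidefinite $k\times k$ matrices; $\mathrm{Sym}^+(n,k)$ the symmetric positive semidefinite $n\times n$ matrices of rank $k$; $\mathrm{Im}$ and $\mathrm{Span}$ denote column space. For a positive semidefinite matrix, $(\cdot)^{1/2}$ is its positive semidefinite square root. $O(r)$ is the orthogonal group ($O(0)$ being trivial). Principal angles: for $k$-dimensional subspaces $P_1=\mathrm{Span}(Q_1)$, $P_2=\mathrm{Span}(Q_2)$ of $\mathbb{R}^n$ with $Q_1,Q_2\in\mathrm{St}(n,k)$, they are the uniquely determined numbers $0\le\theta_1\le\dots\le\theta_k\le\pi/2$ such that the singular values of $Q_1^\top Q_2$ are $\cos\theta_1,\dots,\cos\theta_k$. The set $I_{BW}(\Sigma_1,\Sigma_2)$ is the index set of minimizing Bures--Wasserstein logarithms between $\Sigma_1$ and $\Sigma_2$; for the purpose of the statement it is defined by the displayed formula with the given $X,Y$. *)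

theory Defs
  imports
    Complex_Main
    "Jordan_Normal_Form.Char_Poly"
    "Jordan_Normal_Form.DL_Rank"
begin

definition stiefel :: "nat \<Rightarrow> nat \<Rightarrow> real mat set" where
  "stiefel n k = {Q \<in> carrier_mat n k. Q\<^sup>T * Q = 1\<^sub>m k}"

(* JNF's orthogonal_mat only asks for pairwise orthogonal nonzero columns,
   so it is not the orthogonal group. *)
definition orth_group :: "nat \<Rightarrow> real mat set" where
  "orth_group k = {R \<in> carrier_mat k k. R\<^sup>T * R = 1\<^sub>m k}"

definition cov_mats :: "nat \<Rightarrow> real mat set" where
  "cov_mats k = {A \<in> carrier_mat k k. A\<^sup>T = A \<and>
     (\<forall>v \<in> carrier_vec k. v \<bullet> (A *\<^sub>v v) \<ge> 0)}"

definition spd_mats :: "nat \<Rightarrow> real mat set" where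
  "spd_mats k = {A \<in> carrier_mat k k. A\<^sup>T = A \<and>
     (\<forall>v \<in> carrier_vec k. v \<noteq> 0\<^sub>v k \<longrightarrow> v \<bullet> (A *\<^sub>v v) > 0)}"

definition cov_rank_mats :: "nat \<Rightarrow> nat \<Rightarrow> real mat set" where
  "cov_rank_mats n k = {A \<in> cov_mats n. vec_space.rank n A = k}"

definition psd_sqrt :: "real mat \<Rightarrow> real mat" where
  "psd_sqrt A = (THE B. B \<in> cov_mats (dim_row A) \<and> B * B = A)"

(* Square roots of the eigenvalues of A\<^sup>T * A, with multiplicity.  The characteristic
   polynomial of this symmetric matrix splits over the reals, so there are dim_col A of them. *)
definition singular_values :: "real mat \<Rightarrow> real multiset" where
  "singular_values A = image_mset sqrt (proots (char_poly (A\<^sup>T * A)))"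

(* A list in nondecreasing order, indexed from 0.  The bases Q1, Q2 of P1, P2 are existentially
   quantified because the singular values do not depend on their choice. *)
definition principal_angles ::
    "nat \<Rightarrow> nat \<Rightarrow> real vec set \<Rightarrow> real vec set \<Rightarrow> real list" where
  "principal_angles n k P1 P2 = (THE \<theta>s. length \<theta>s = k \<and> sorted \<theta>s \<and> set \<theta>s \<subseteq> {0..pi / 2} \<and>
     (\<exists>Q1 \<in> stiefel n k. \<exists>Q2 \<in> stiefel n k.
        P1 = vec_space.col_space n Q1 \<and> P2 = vec_space.col_space n Q2 \<and>
        singular_values (Q1\<^sup>T * Q2) = mset (map cos \<theta>s)))"

(* Stated for factors X, Y of \<Sigma>1 = X * X\<^sup>T and \<Sigma>2 = Y * Y\<^sup>T. *)
definition I_BW :: "real mat \<Rightarrow> real mat \<Rightarrow> real mat set" where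
  "I_BW X Y = {R \<in> orth_group (dim_col X). X\<^sup>T * Y * R \<in> cov_mats (dim_col X)}"

end

theory Submission
  imports Defs
begin

text \<open>
  Put \<open>A = Q1\<^sup>T Q2\<close> and \<open>M = X\<^sup>T Y\<close>.  Since \<open>M\<close> is \<open>A\<close> multiplied on both sides by the invertible square
  roots of \<open>D1\<close> and \<open>D2\<close>, both have rank \<open>l\<close>.  The cosines of the principal angles are the singular values
  of \<open>A\<close>, and a right angle is a zero singular value, so there are \<open>k - l\<close> of them
  (\<open>card_right_principal_angles\<close>).  For this the angles must be shown to exist and to be independent of
  the chosen orthonormal bases (\<open>principal_angles_stiefel\<close>).

  If \<open>M R\<close> is positive semidefinite for an orthogonal \<open>R\<close>, its square is \<open>M R R\<^sup>T M\<^sup>T = M M\<^sup>T\<close>, and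
  \<open>M M\<^sup>T = X\<^sup>T \<Sigma>2 X\<close>.  As positive semidefinite square roots are unique (\<open>cov_mats_square_inj\<close>), this
  gives the second description of the index set (\<open>cov_mult_orth_iff_psd_sqrt\<close>).

  For the bijection take a singular value decomposition \<open>M V = U S\<close>, with \<open>S\<close> diagonal and its \<open>l\<close> nonzero
  entries first.  Substituting \<open>R = V W U\<^sup>T\<close>, the condition becomes \<open>S W = S\<close>, which says that \<open>W\<close> is block
  diagonal with an identity of size \<open>l\<close> and an arbitrary orthogonal matrix of size \<open>k - l = r\<close>
  (\<open>cov_mult_orth_bij\<close>).

  Everything rests on the spectral theorem for real symmetric matrices
  (\<open>symmetric_orthogonal_diagonalisation\<close>), applied to positive semidefinite matrices, to
  differences of their square roots, and to Gram matrices \<open>M\<^sup>T M\<close>.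
\<close>

section \<open>Orthogonal matrices and orthonormal columns\<close>

lemma orth_group_carrier: "R \<in> orth_group k \<Longrightarrow> R \<in> carrier_mat k k"
  by (simp add: orth_group_def)

lemma orth_group_left: "R \<in> orth_group k \<Longrightarrow> R\<^sup>T * R = 1\<^sub>m k"
  by (simp add: orth_group_def)

lemma orth_group_right: "R \<in> orth_group k \<Longrightarrow> R * R\<^sup>T = 1\<^sub>m k"
  unfolding orth_group_def by (auto intro: mat_mult_left_right_inverse)

lemma orth_group_transpose: "R \<in> orth_group k \<Longrightarrow> R\<^sup>T \<in> orth_group k"
  using orth_group_right by (auto simp: orth_group_def)

lemma orth_group_cancel:
  assumes R: "R \<in> orth_group k" and B: "B \<in> carrier_mat k m"
  shows "R * (R\<^sup>T * B) = B" "R\<^sup>T * (R * B) = B"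
proof -
  have c: "R \<in> carrier_mat k k" "R\<^sup>T \<in> carrier_mat k k"
    using orth_group_carrier[OF R] by auto
  show "R * (R\<^sup>T * B) = B"
    using assoc_mult_mat[OF c B] orth_group_right[OF R] B by simp
  show "R\<^sup>T * (R * B) = B"
    using assoc_mult_mat[OF c(2,1) B] orth_group_left[OF R] B by simp
qed

lemma stiefel_mult:
  assumes Q: "Q \<in> stiefel n k" and R: "R \<in> stiefel k m"
  shows "Q * R \<in> stiefel n m"
proof -
  have c: "Q \<in> carrier_mat n k" "R \<in> carrier_mat k m" "Q\<^sup>T * Q = 1\<^sub>m k" "R\<^sup>T * R = 1\<^sub>m m"
    using assms by (auto simp: stiefel_def)
  have "(Q * R)\<^sup>T * (Q * R) = R\<^sup>T * Q\<^sup>T * (Q * R)"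
    using c by (simp add: transpose_mult)
  also have "\<dots> = R\<^sup>T * ((Q\<^sup>T * Q) * R)"
    using c(1,2) by (simp add: assoc_mult_mat[of _ m k _ n _ m] assoc_mult_mat[of _ k n _ k _ m])
  finally show ?thesis using c by (simp add: stiefel_def)
qed

lemma orth_group_eq_stiefel: "orth_group k = stiefel k k"
  by (simp add: orth_group_def stiefel_def)

lemma orth_group_mult: "Q \<in> orth_group k \<Longrightarrow> R \<in> orth_group k \<Longrightarrow> Q * R \<in> orth_group k"
  unfolding orth_group_eq_stiefel by (rule stiefel_mult)

lemma stiefel_col_scalar_prod:
  assumes Q: "Q \<in> stiefel n k" and ij: "i < k" "j < k"
  shows "col Q i \<bullet> col Q j = (if i = j then 1 else 0)"
proof -
  have Qc: "Q \<in> carrier_mat n k" and "(Q\<^sup>T * Q) $$ (i,j) = (1\<^sub>m k) $$ (i,j)"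
    using Q by (simp_all add: stiefel_def)
  moreover have "(Q\<^sup>T * Q) $$ (i,j) = col Q i \<bullet> col Q j"
    using Qc ij by simp
  ultimately show ?thesis using ij by simp
qed

lemma stiefel_carrier: "Q \<in> stiefel n k \<Longrightarrow> Q \<in> carrier_mat n k"
  by (simp add: stiefel_def)

lemma stiefelI:
  assumes Q: "Q \<in> carrier_mat n k"
    and cols: "\<And>i j. i < k \<Longrightarrow> j < k \<Longrightarrow> col Q i \<bullet> col Q j = (if i = j then 1 else 0)"
  shows "Q \<in> stiefel n k"
  unfolding stiefel_def using Q cols by (auto intro!: eq_matI)

lemma scalar_prod_self_nonneg: "(v :: real Matrix.vec) \<bullet> v \<ge> 0"
  by (auto simp: scalar_prod_def intro: sum_nonneg)

lemma scalar_prod_self_eq_0: "v \<in> carrier_vec n \<Longrightarrow> (v :: real Matrix.vec) \<bullet> v = 0 \<longleftrightarrow> v = 0\<^sub>v n"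
  using conjugate_square_eq_0_vec[of v n] by simp

text \<open>The reflection that exchanges \<open>v\<close> and the first unit vector \<open>e\<close>, namely
  \<open>1 - 2 w w\<^sup>T / (w \<bullet> w)\<close> with \<open>w = v - e\<close>.  In the degenerate case \<open>v = e\<close> the identity matrix serves.\<close>
lemma orth_group_first_column:
  assumes v: "v \<in> carrier_vec n" and v1: "v \<bullet> v = 1" and n: "0 < n"
  shows "\<exists>H \<in> orth_group n. col H 0 = v"
proof (cases "v = unit_vec n 0")
  case True
  then show ?thesis using n by (intro bexI[of _ "1\<^sub>m n"]) (auto simp: orth_group_def)
next
  case False
  define w where "w = v - unit_vec n 0"
  have w: "w \<in> carrier_vec n" using v by (simp add: w_def)
  have wi: "w $ i = v $ i - (if i = 0 then 1 else 0)" if "i < n" for i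
    using that v by (simp add: w_def)
  have "w \<noteq> 0\<^sub>v n"
  proof
    assume "w = 0\<^sub>v n"
    then have "v $ i = unit_vec n 0 $ i" if "i < n" for i
      using wi[OF that] that by simp
    then show False using False v by (metis carrier_vecD eq_vecI index_unit_vec(3))
  qed
  then have ww0: "w \<bullet> w \<noteq> 0" using scalar_prod_self_eq_0[OF w] by simp
  have "w \<bullet> w = (\<Sum>i<n. (v $ i - (if i = 0 then 1 else 0))\<^sup>2)"
    using w wi by (auto simp: scalar_prod_def power2_eq_square atLeast0LessThan intro!: sum.cong)
  also have "\<dots> = (\<Sum>i<n. v $ i * v $ i + (if i = 0 then 1 - 2 * v $ i else 0))"
    by (rule sum.cong) (auto simp: power2_eq_square algebra_simps)
  also have "\<dots> = v \<bullet> v + (1 - 2 * v $ 0)"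
    using v n by (simp add: sum.distrib scalar_prod_def atLeast0LessThan)
  finally have ww: "w \<bullet> w = 2 - 2 * v $ 0" using v1 by simp
  define c where "c = 2 / (w \<bullet> w)"
  define H where "H = Matrix.mat n n (\<lambda>(i,j). (if i = j then 1 else 0) - c * w $ i * w $ j)"
  have Hc: "H \<in> carrier_mat n n" by (simp add: H_def)
  have "H\<^sup>T * H = 1\<^sub>m n"
  proof (rule eq_matI)
    fix i j assume "i < dim_row (1\<^sub>m n)" "j < dim_col (1\<^sub>m n)"
    then have i: "i < n" and j: "j < n" by auto
    have "(H\<^sup>T * H) $$ (i,j) = (\<Sum>a<n. ((if a = i then 1 else 0) - c * w $ a * w $ i) *
        ((if a = j then 1 else 0) - c * w $ a * w $ j))"
      using i j by (simp add: H_def scalar_prod_def atLeast0LessThan)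
    also have "\<dots> = (\<Sum>a<n. (if a = i then (if a = j then 1 else 0) - c * w $ a * w $ j else 0)
        - (if a = j then c * w $ a * w $ i else 0) + c\<^sup>2 * w $ i * w $ j * (w $ a * w $ a))"
      by (rule sum.cong) (auto simp: power2_eq_square algebra_simps)
    also have "\<dots> = (if i = j then 1 else 0) - 2 * c * w $ i * w $ j
        + c\<^sup>2 * w $ i * w $ j * (w \<bullet> w)"
      using i j w by (simp add: sum.distrib sum_subtractf scalar_prod_def atLeast0LessThan
          flip: sum_distrib_left)
    also have "c\<^sup>2 * w $ i * w $ j * (w \<bullet> w) = 2 * c * w $ i * w $ j"
      using ww0 by (simp add: c_def power2_eq_square)
    finally show "(H\<^sup>T * H) $$ (i,j) = (1\<^sub>m n) $$ (i,j)" using i j by simp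
  qed (auto simp: H_def)
  moreover have "col H 0 = v"
  proof (rule eq_vecI)
    fix i assume "i < dim_vec v"
    then have i: "i < n" using v by simp
    have "c * w $ 0 = - 1"
      using ww ww0 wi[OF n] by (simp add: c_def field_simps)
    then have "c * w $ i * w $ 0 = - (w $ i)" by (metis mult.commute mult.left_commute mult_minus1)
    then show "col H 0 $ i = v $ i" using i n wi[OF i] by (simp add: H_def)
  qed (use v in \<open>simp add: H_def\<close>)
  ultimately show ?thesis using Hc by (auto simp: orth_group_def)
qed

section \<open>The spectral theorem for real symmetric matrices\<close>

text \<open>Over the complex numbers the characteristic polynomial splits.  If \<open>A v = a v\<close> with a complex
  \<open>v \<noteq> 0\<close>, then \<open>F = v\<^sup>* A v = a (v\<^sup>* v)\<close> is its own conjugate because \<open>A\<close> is real symmetric, and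
  \<open>v\<^sup>* v\<close> is a nonzero real number; so \<open>a\<close> is real.\<close>
lemma symmetric_char_poly_splits:
  fixes A :: "real mat"
  assumes A: "A \<in> carrier_mat n n" and sym: "A\<^sup>T = A"
  shows "\<exists>es. char_poly A = (\<Prod>e\<leftarrow>es. [:- e, 1:])"
proof -
  let ?c = "complex_of_real"
  let ?A = "map_mat ?c A"
  have Ac: "?A \<in> carrier_mat n n" using A by simp
  obtain as where as: "char_poly ?A = (\<Prod>a\<leftarrow>as. [:- a, 1:])"
    using char_poly_factorized[OF Ac] by blast
  have real: "a \<in> \<real>" if "a \<in> set as" for a
  proof -
    have "poly (char_poly ?A) a = 0" using that unfolding as by (simp add: poly_prod_list prod_list_zero_iff image_iff)
    then have "eigenvalue ?A a" using eigenvalue_root_char_poly[OF Ac] by simp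
    then obtain v where v: "v \<in> carrier_vec n" "v \<noteq> 0\<^sub>v n" "?A *\<^sub>v v = a \<cdot>\<^sub>v v"
      using Ac unfolding eigenvalue_def eigenvector_def by auto
    have sA: "A $$ (j,i) = A $$ (i,j)" if "i < n" "j < n" for i j
      using sym A that by (metis index_transpose_mat(1) carrier_matD)
    have Av: "(\<Sum>j<n. ?c (A $$ (i,j)) * v $ j) = a * v $ i" if "i < n" for i
    proof -
      have "(?A *\<^sub>v v) $ i = (a \<cdot>\<^sub>v v) $ i" by (simp only: v)
      then show ?thesis using that A v(1) by (simp add: scalar_prod_def atLeast0LessThan)
    qed
    define N where "N = (\<Sum>i<n. cnj (v $ i) * v $ i)"
    define F where "F = (\<Sum>i<n. \<Sum>j<n. cnj (v $ i) * ?c (A $$ (i,j)) * v $ j)"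
    have "F = (\<Sum>i<n. cnj (v $ i) * (\<Sum>j<n. ?c (A $$ (i,j)) * v $ j))"
      by (simp add: F_def sum_distrib_left mult.assoc)
    also have "\<dots> = (\<Sum>i<n. cnj (v $ i) * (a * v $ i))"
      by (intro sum.cong refl) (simp add: Av)
    also have "\<dots> = a * N"
      by (simp add: N_def sum_distrib_left mult_ac)
    finally have FN: "F = a * N" .
    have "cnj F = (\<Sum>i<n. \<Sum>j<n. v $ i * ?c (A $$ (i,j)) * cnj (v $ j))"
      by (simp add: F_def)
    also have "\<dots> = (\<Sum>j<n. \<Sum>i<n. v $ i * ?c (A $$ (i,j)) * cnj (v $ j))"
      by (rule sum.swap)
    also have "\<dots> = F" unfolding F_def
      by (intro sum.cong refl) (simp add: sA)
    finally have F: "cnj F = F" .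
    have N: "cnj N = N" by (simp add: N_def mult.commute)
    have "N \<noteq> 0"
    proof
      assume "N = 0"
      have "N = ?c (\<Sum>i<n. (cmod (v $ i))\<^sup>2)"
        by (simp add: N_def complex_norm_square mult.commute del: of_real_power)
      with \<open>N = 0\<close> have "(\<Sum>i<n. (cmod (v $ i))\<^sup>2) = 0" by (metis of_real_eq_0_iff)
      then have "\<forall>i<n. v $ i = 0" by (subst (asm) sum_nonneg_eq_0_iff) auto
      then show False using v(1,2) by (auto intro!: eq_vecI)
    qed
    with FN F N have "cnj a = a" by (metis complex_cnj_mult mult_cancel_right)
    then show ?thesis by (simp add: Reals_cnj_iff)
  qed
  define es where "es = map Re as"
  have as_es: "as = map ?c es"
    using real by (auto simp: es_def intro!: map_idI[symmetric] of_real_Re)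
  interpret map_poly_inj_idom_hom ?c ..
  have "map_poly ?c (char_poly A) = map_poly ?c (\<Prod>e\<leftarrow>es. [:- e, 1:])"
    unfolding of_real_hom.char_poly_hom[OF A, symmetric] as as_es
    by (simp add: hom_prod_list o_def)
  then have "char_poly A = (\<Prod>e\<leftarrow>es. [:- e, 1:])" by (simp del: hom_prod_list)
  then show ?thesis by blast
qed

lemma transpose_conjugate:
  fixes A :: "real mat"
  assumes "A \<in> carrier_mat n n" "A\<^sup>T = A" "U \<in> carrier_mat n m"
  shows "(U\<^sup>T * A * U)\<^sup>T = U\<^sup>T * A * U"
proof -
  have "(U\<^sup>T * A * U)\<^sup>T = U\<^sup>T * (U\<^sup>T * A)\<^sup>T"
    using assms by (intro transpose_mult[of _ m n _ m]) auto
  also have "(U\<^sup>T * A)\<^sup>T = A * U"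
    using assms by (subst transpose_mult[of _ m n _ n]) auto
  finally show ?thesis using assms by simp
qed

lemma orth_group_block:
  assumes V: "V \<in> orth_group m"
  shows "four_block_mat (1\<^sub>m l) (0\<^sub>m l m) (0\<^sub>m m l) V \<in> orth_group (l + m)" (is "?W \<in> _")
proof -
  have Vc: "V \<in> carrier_mat m m" and VV: "V\<^sup>T * V = 1\<^sub>m m"
    using V by (auto simp: orth_group_def)
  have "?W\<^sup>T = four_block_mat (1\<^sub>m l) (0\<^sub>m l m) (0\<^sub>m m l) V\<^sup>T"
    using Vc by (subst transpose_four_block_mat[of _ l l _ m _ m]) auto
  then have "?W\<^sup>T * ?W = four_block_mat (1\<^sub>m l) (0\<^sub>m l m) (0\<^sub>m m l) (1\<^sub>m m)"
    using Vc VV by (simp add: mult_four_block_mat[of _ l l _ m _ m _ _ l _ m])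
  also have "\<dots> = 1\<^sub>m (l + m)" by (rule eq_matI) auto
  finally show ?thesis using Vc by (simp add: orth_group_def)
qed

text \<open>Induction on the list of roots.  Completing a unit eigenvector to an orthogonal matrix \<open>H\<close> makes the
  first column of \<open>H\<^sup>T A H\<close> a multiple of the first unit vector; symmetry then clears the first row,
  and the remaining diagonal block is symmetric with the remaining roots.  The order of \<open>es\<close> is
  free, which allows zero eigenvalues to be placed last.\<close>
lemma symmetric_orthogonal_diagonalisation:
  fixes A :: "real mat"
  assumes "A \<in> carrier_mat n n" "A\<^sup>T = A" "char_poly A = (\<Prod>e\<leftarrow>es. [:- e, 1:])"
  shows "\<exists>U \<in> orth_group n. U\<^sup>T * A * U = mat_diag n (\<lambda>i. es ! i)"
  using assms
proof (induction es arbitrary: n A)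
  case Nil
  then have "n = 0" using degree_monic_char_poly[of A n] by simp
  then show ?case using Nil(1) by (intro bexI[of _ "1\<^sub>m 0"]) (auto simp: orth_group_def mat_diag_def intro!: eq_matI)
next
  case (Cons e es)
  note A = Cons.prems(1) and sym = Cons.prems(2)
  have mon: "monic (\<Prod>e\<leftarrow>es. [:- e, 1:])" by (rule monic_prod_list) auto
  have cp: "char_poly A = [:- e, 1:] * (\<Prod>e\<leftarrow>es. [:- e, 1:])" using Cons.prems(3) by simp
  have "degree (char_poly A) = Suc (degree (\<Prod>e\<leftarrow>es. [:- e, 1:]))"
    unfolding cp by (subst degree_mult_eq, insert mon, auto)
  then obtain m where n: "n = Suc m" using degree_monic_char_poly[OF A] by (cases n) auto
  have "eigenvalue A e" unfolding eigenvalue_root_char_poly[OF A] cp by simp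
  then obtain v where v: "v \<in> carrier_vec n" "v \<noteq> 0\<^sub>v n" "A *\<^sub>v v = e \<cdot>\<^sub>v v"
    using A unfolding eigenvalue_def eigenvector_def by auto
  define u where "u = (1 / sqrt (v \<bullet> v)) \<cdot>\<^sub>v v"
  have vv: "v \<bullet> v > 0"
    using scalar_prod_self_eq_0[OF v(1)] scalar_prod_self_nonneg[of v] v(2) by simp
  have u: "u \<in> carrier_vec n" using v by (simp add: u_def)
  have uu: "u \<bullet> u = 1" using v vv by (simp add: u_def divide_simps)
  have Au: "A *\<^sub>v u = e \<cdot>\<^sub>v u"
    using A v by (simp add: u_def mult_mat_vec[of A n n] smult_smult_assoc mult.commute)
  obtain H where H: "H \<in> orth_group n" "col H 0 = u"
    using orth_group_first_column[OF u uu] n by auto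
  have Hc: "H \<in> carrier_mat n n" using H orth_group_carrier by auto
  define A' where "A' = H\<^sup>T * A * H"
  have A'c: "A' \<in> carrier_mat n n" using A Hc by (simp add: A'_def)
  have symA': "A'\<^sup>T = A'" unfolding A'_def by (rule transpose_conjugate[OF A sym Hc])
  have symA'i: "A' $$ (i,j) = A' $$ (j,i)" if "i < n" "j < n" for i j
    using symA' that A'c by (metis carrier_matD index_transpose_mat(1))
  have A'0: "A' $$ (i,0) = (if i = 0 then e else 0)" if i: "i < n" for i
  proof -
    have "A' = H\<^sup>T * (A * H)" using A Hc by (simp add: A'_def)
    then have "A' $$ (i,0) = col H i \<bullet> (A *\<^sub>v col H 0)"
      using i n A Hc by (simp add: mult_mat_vec_def scalar_prod_def)
    also have "\<dots> = e * (col H i \<bullet> col H 0)"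
      using H Au u Hc i by simp
    finally show ?thesis
      using stiefel_col_scalar_prod[OF H(1)[unfolded orth_group_eq_stiefel] i] n by simp
  qed
  define A3 where "A3 = Matrix.mat m m (\<lambda>(i,j). A' $$ (Suc i, Suc j))"
  have A3c: "A3 \<in> carrier_mat m m" by (simp add: A3_def)
  have A3s: "A3\<^sup>T = A3" using symA'i n by (auto simp: A3_def)
  let ?E = "Matrix.mat 1 1 (\<lambda>_. e)"
  have A'b: "A' = four_block_mat ?E (0\<^sub>m 1 m) (0\<^sub>m m 1) A3"
  proof (rule eq_matI)
    fix i j
    assume "i < dim_row (four_block_mat ?E (0\<^sub>m 1 m) (0\<^sub>m m 1) A3)"
      "j < dim_col (four_block_mat ?E (0\<^sub>m 1 m) (0\<^sub>m m 1) A3)"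
    then have ij: "i < n" "j < n" using n by (auto simp: A3_def)
    then show "A' $$ (i,j) = four_block_mat ?E (0\<^sub>m 1 m) (0\<^sub>m m 1) A3 $$ (i,j)"
      using A'0[of i] A'0[of j] symA'i[of 0 j] n by (auto simp: A3_def)
  qed (use A'c n in \<open>auto simp: A3_def\<close>)
  have "similar_mat A' A" unfolding similar_mat_def
    using A'c A Hc orth_group_left[OF H(1)] orth_group_right[OF H(1)]
    by (intro exI[of _ "H\<^sup>T"] exI[of _ H]) (auto simp: similar_mat_wit_def A'_def Let_def)
  then have "char_poly A' = [:- e, 1:] * (\<Prod>e\<leftarrow>es. [:- e, 1:])"
    using char_poly_similar cp by metis
  moreover have "char_poly A' = char_poly ?E * char_poly A3"
    unfolding A'b by (rule char_poly_four_block_zeros_col) (auto simp: A3_def)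
  moreover have "char_poly ?E = [:- e, 1:]"
    by (simp add: char_poly_defs det_def sign_def)
  ultimately have "char_poly A3 = (\<Prod>e\<leftarrow>es. [:- e, 1:])"
    by (metis mult_cancel_left pCons_eq_0_iff zero_neq_one)
  from Cons.IH[OF A3c A3s this] obtain V where V: "V \<in> orth_group m"
    and VA: "V\<^sup>T * A3 * V = mat_diag m (\<lambda>i. es ! i)" by blast
  have Vc: "V \<in> carrier_mat m m" using V orth_group_carrier by auto
  let ?W = "four_block_mat (1\<^sub>m 1) (0\<^sub>m 1 m) (0\<^sub>m m 1) V"
  have W: "?W \<in> orth_group n" using orth_group_block[OF V, of 1] n by simp
  have Wc: "?W \<in> carrier_mat n n" using W orth_group_carrier by auto
  have "(H * ?W)\<^sup>T * A * (H * ?W) = ?W\<^sup>T * A' * ?W"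
    using Hc Wc A by (simp add: A'_def transpose_mult[of _ n n _ n] assoc_mult_mat[of _ n n _ n _ n])
  also have "?W\<^sup>T = four_block_mat (1\<^sub>m 1) (0\<^sub>m 1 m) (0\<^sub>m m 1) V\<^sup>T"
    using Vc by (subst transpose_four_block_mat[of _ 1 1 _ m _ m]) auto
  also have "\<dots> * A' * ?W = four_block_mat ?E (0\<^sub>m 1 m) (0\<^sub>m m 1) (V\<^sup>T * A3 * V)"
    unfolding A'b using Vc A3c
    by (simp add: mult_four_block_mat[of _ 1 1 _ m _ m _ _ 1 _ m])
  also have "\<dots> = mat_diag n (\<lambda>i. (e # es) ! i)"
    unfolding VA by (rule eq_matI) (auto simp: mat_diag_def n nth_Cons')
  finally show ?case using orth_group_mult[OF H(1) W] by blast
qed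

text \<open>The eigenvalue \<open>d i\<close> belongs to column \<open>i\<close> of \<open>U\<close>.  With the zero eigenvalues at the end, the
  first \<open>l\<close> columns span the image of \<open>A\<close> and the others its kernel.\<close>
lemma spectral_theorem_zeros_last:
  fixes A :: "real mat"
  assumes A: "A \<in> carrier_mat n n" and sym: "A\<^sup>T = A"
  obtains U d l where "U \<in> orth_group n" "A * U = U * mat_diag n d" "l \<le> n"
    "\<And>i. i < l \<Longrightarrow> d i \<noteq> 0" "\<And>i. l \<le> i \<Longrightarrow> i < n \<Longrightarrow> d i = 0"
proof -
  obtain as where "char_poly A = (\<Prod>e\<leftarrow>as. [:- e, 1:])"
    using symmetric_char_poly_splits[OF A sym] by blast
  define es where "es = filter (\<lambda>e. e \<noteq> 0) as @ filter (\<lambda>e. e = 0) as"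
  let ?l = "length (filter (\<lambda>e. e \<noteq> 0) as)"
  have "mset (filter (\<lambda>e. e \<noteq> 0) as) + mset (filter (\<lambda>e. e = 0) as) = mset as"
    using multiset_partition[of "mset as" "\<lambda>e. e \<noteq> 0"] by simp
  then have mset: "mset es = mset as" by (simp add: es_def)
  have "(\<Prod>e\<leftarrow>es. [:- e, 1:]) = (\<Prod>e\<leftarrow>as. [:- e, 1:])"
    using arg_cong[OF mset, of "\<lambda>M. prod_mset (image_mset (\<lambda>e. [:- e, 1:]) M)"]
    by (simp add: prod_mset_prod_list flip: mset_map)
  with \<open>char_poly A = _\<close> have cp: "char_poly A = (\<Prod>e\<leftarrow>es. [:- e, 1:])" by simp
  then have len: "length es = n"
    using degree_monic_char_poly[OF A] degree_linear_factors[of uminus es] by simp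
  obtain U where U: "U \<in> orth_group n" and "U\<^sup>T * A * U = mat_diag n (\<lambda>i. es ! i)"
    using symmetric_orthogonal_diagonalisation[OF A sym cp] by blast
  moreover have "U * (U\<^sup>T * A * U) = A * U"
    using orth_group_carrier[OF U] A orth_group_cancel(1)[OF U, of "A * U" n]
    by (simp add: assoc_mult_mat[of _ n n _ n _ n])
  ultimately have "A * U = U * mat_diag n (\<lambda>i. es ! i)" by simp
  moreover have "es ! i \<noteq> 0" if "i < ?l" for i
    using that nth_mem[OF that] by (simp add: es_def nth_append)
  moreover have "es ! i = 0" if "?l \<le> i" "i < n" for i
  proof -
    have "i - ?l < length (filter (\<lambda>e. e = 0) as)" using that len by (simp add: es_def)
    from nth_mem[OF this] show ?thesis using that by (simp add: es_def nth_append)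
  qed
  moreover have "?l \<le> n" using len by (simp add: es_def)
  ultimately show thesis using that U by blast
qed

section \<open>Square roots of positive semidefinite matrices\<close>

lemma mult_eigenbasis_col:
  fixes A :: "real mat"
  assumes A: "A \<in> carrier_mat m n" and U: "U \<in> carrier_mat n k" and W: "W \<in> carrier_mat m k"
    and AU: "A * U = W * mat_diag k d" and j: "j < k"
  shows "A *\<^sub>v col U j = d j \<cdot>\<^sub>v col W j"
proof -
  have "A *\<^sub>v col U j = col (A * U) j" by (rule col_mult2[OF A U j, symmetric])
  also have "\<dots> = d j \<cdot>\<^sub>v col W j"
    unfolding AU mat_diag_mult_right[OF W] using W j by (auto intro!: eq_vecI)
  finally show ?thesis .
qed

lemma mat_diag_mult_vec:
  fixes y :: "real Matrix.vec"
  assumes "y \<in> carrier_vec m"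
  shows "mat_diag m d *\<^sub>v y = Matrix.vec m (\<lambda>i. d i * y $ i)"
  using assms by (auto simp: mat_diag_def scalar_prod_def intro!: eq_vecI)
    (simp add: if_distrib[of "\<lambda>x. x * _"] cong: if_cong)

lemma conj_mat_diag_cov:
  assumes U: "U \<in> carrier_mat n m" and d: "\<And>i. i < m \<Longrightarrow> d i \<ge> 0"
  shows "U * mat_diag m d * U\<^sup>T \<in> cov_mats n"
proof -
  have D: "mat_diag m d \<in> carrier_mat m m" by simp
  have "(mat_diag m d)\<^sup>T = mat_diag m d" by (auto simp: mat_diag_def)
  then have "(U * mat_diag m d * U\<^sup>T)\<^sup>T = U * mat_diag m d * U\<^sup>T"
    using transpose_conjugate[OF D, of "U\<^sup>T" n] U by simp
  moreover have "v \<bullet> ((U * mat_diag m d * U\<^sup>T) *\<^sub>v v) \<ge> 0" if v: "v \<in> carrier_vec n" for v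
  proof -
    let ?y = "U\<^sup>T *\<^sub>v v"
    have y: "?y \<in> carrier_vec m" using U v by simp
    note Dy = mat_diag_mult_vec[OF y]
    have "(U * mat_diag m d * U\<^sup>T) *\<^sub>v v = U *\<^sub>v (mat_diag m d *\<^sub>v ?y)"
      using U v by (simp add: assoc_mult_mat_vec[of _ n m _ n] assoc_mult_mat_vec[of _ m m _ n]
          assoc_mult_mat[of _ n m _ m _ n] mult_carrier_mat[of _ m m _ n])
    then have "v \<bullet> ((U * mat_diag m d * U\<^sup>T) *\<^sub>v v) = ?y \<bullet> (mat_diag m d *\<^sub>v ?y)"
      using transpose_vec_mult_scalar[OF U _ v, of "mat_diag m d *\<^sub>v ?y"] Dy by simp
    also have "\<dots> = (\<Sum>i<m. d i * (?y $ i)\<^sup>2)"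
      unfolding Dy using U by (simp add: scalar_prod_def power2_eq_square atLeast0LessThan mult_ac)
    also have "\<dots> \<ge> 0" using d by (intro sum_nonneg) auto
    finally show ?thesis .
  qed
  moreover have "U * mat_diag m d * U\<^sup>T \<in> carrier_mat n n"
    by (rule mult_carrier_mat[OF mult_carrier_mat[OF U D]]) (simp add: U)
  ultimately show ?thesis by (simp add: cov_mats_def del: assoc_mult_mat)
qed

text \<open>If \<open>u\<close> is a unit eigenvector of \<open>B - C\<close> with eigenvalue \<open>d\<close>, then \<open>B u = C u + d u\<close>, while
  \<open>B u\<close> and \<open>C u\<close> have the same length since \<open>B\<^sup>2 = C\<^sup>2\<close>.  Expanding gives
  \<open>d (u \<bullet> B u + u \<bullet> C u) = 0\<close>.  For \<open>d \<noteq> 0\<close> both nonnegative summands vanish, but their difference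
  is \<open>d\<close>.  So \<open>B - C\<close> has only the eigenvalue zero.\<close>
lemma cov_mats_square_inj:
  assumes B: "B \<in> cov_mats n" and C: "C \<in> cov_mats n" and eq: "B * B = C * C"
  shows "B = C"
proof -
  have c: "B \<in> carrier_mat n n" "C \<in> carrier_mat n n" and s: "B\<^sup>T = B" "C\<^sup>T = C"
    using B C by (auto simp: cov_mats_def)
  define E where "E = B - C"
  have E: "E \<in> carrier_mat n n" using c by (simp add: E_def minus_carrier_mat)
  have "E\<^sup>T = E" using c s by (simp add: E_def transpose_minus)
  obtain U d l where U: "U \<in> orth_group n" and EU: "E * U = U * mat_diag n d"
    using spectral_theorem_zeros_last[OF E \<open>E\<^sup>T = E\<close>] by metis
  have Uc: "U \<in> carrier_mat n n" using U by (rule orth_group_carrier)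
  have "d i = 0" if i: "i < n" for i
  proof -
    define u p q where "u = col U i" and "p = B *\<^sub>v u" and "q = C *\<^sub>v u"
    have v: "u \<in> carrier_vec n" "p \<in> carrier_vec n" "q \<in> carrier_vec n"
      using c Uc i by (auto simp: u_def p_def q_def)
    have uu: "u \<bullet> u = 1"
      using stiefel_col_scalar_prod[of U n n i i] U i by (simp add: u_def orth_group_eq_stiefel)
    have diff: "p - q = d i \<cdot>\<^sub>v u"
      using mult_eigenbasis_col[OF E Uc Uc EU i] c v
      by (simp add: E_def p_def q_def u_def minus_mult_distrib_mat_vec[of _ n n])
    have pq: "p = q + d i \<cdot>\<^sub>v u"
    proof (rule eq_vecI)
      fix j assume "j < dim_vec (q + d i \<cdot>\<^sub>v u)"
      then show "p $ j = (q + d i \<cdot>\<^sub>v u) $ j"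
        using arg_cong[OF diff, of "\<lambda>x. x $ j"] v by simp
    qed (use v in simp)
    have "p \<bullet> p = u \<bullet> ((B * B) *\<^sub>v u)"
      using transpose_vec_mult_scalar[OF c(1) v(2) v(1)] c v s by (simp add: p_def)
    also have "\<dots> = q \<bullet> q"
      unfolding eq using transpose_vec_mult_scalar[OF c(2) v(3) v(1)] c v s by (simp add: q_def)
    finally have "p \<bullet> p = q \<bullet> q" .
    moreover have "p \<bullet> p = q \<bullet> q + 2 * d i * (u \<bullet> q) + (d i)\<^sup>2"
      unfolding pq using v uu comm_scalar_prod[OF v(1,3)]
      by (simp add: add_scalar_prod_distrib[of _ n] scalar_prod_add_distrib[of _ n]
          power2_eq_square algebra_simps)
    ultimately have "d i * (2 * (u \<bullet> q) + d i) = 0"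
      by (simp add: power2_eq_square algebra_simps)
    moreover have "u \<bullet> p = u \<bullet> q + d i"
      unfolding pq using v uu by (simp add: scalar_prod_add_distrib[of _ n])
    moreover have "u \<bullet> p \<ge> 0" "u \<bullet> q \<ge> 0"
      using B C v by (auto simp: cov_mats_def p_def q_def)
    ultimately show "d i = 0" by auto
  qed
  then have "mat_diag n d = 0\<^sub>m n n" by (auto simp: mat_diag_def)
  then have "E * U = 0\<^sub>m n n" using EU Uc by simp
  then have "E * (U * U\<^sup>T) = 0\<^sub>m n n"
    using assoc_mult_mat[OF E Uc, of "U\<^sup>T" n] Uc by simp
  then have E0: "E = 0\<^sub>m n n" using orth_group_right[OF U] E by simp
  show "B = C"
  proof (rule eq_matI)
    fix i j assume "i < dim_row C" "j < dim_col C"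
    then show "B $$ (i,j) = C $$ (i,j)"
      using arg_cong[OF E0, of "\<lambda>M. M $$ (i,j)"] c by (simp add: E_def)
  qed (use carrier_matD[OF c(1)] carrier_matD[OF c(2)] in simp_all)
qed

lemma cov_mats_square_root_exists:
  assumes A: "A \<in> cov_mats n"
  shows "\<exists>B \<in> cov_mats n. B * B = A"
proof -
  have Ac: "A \<in> carrier_mat n n" and s: "A\<^sup>T = A" using A by (auto simp: cov_mats_def)
  obtain U d l where U: "U \<in> orth_group n" and AU: "A * U = U * mat_diag n d"
    using spectral_theorem_zeros_last[OF Ac s] by metis
  have Uc: "U \<in> carrier_mat n n" using U by (rule orth_group_carrier)
  have d: "d i \<ge> 0" if i: "i < n" for i
  proof -
    let ?u = "col U i"
    have u: "?u \<in> carrier_vec n" using Uc i by simp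
    have "?u \<bullet> (A *\<^sub>v ?u) = d i * (?u \<bullet> ?u)"
      using mult_eigenbasis_col[OF Ac Uc Uc AU i] u by simp
    moreover have "?u \<bullet> ?u = 1"
      using stiefel_col_scalar_prod[of U n n i i] U i by (simp add: orth_group_eq_stiefel)
    moreover have "?u \<bullet> (A *\<^sub>v ?u) \<ge> 0" using A u by (simp add: cov_mats_def)
    ultimately show ?thesis by simp
  qed
  define R where "R = mat_diag n (\<lambda>i. sqrt (d i))"
  have Rc: "R \<in> carrier_mat n n" by (simp add: R_def)
  let ?B = "U * R * U\<^sup>T"
  have Ut: "U\<^sup>T \<in> carrier_mat n n" using Uc by simp
  note c = Ut mult_carrier_mat[OF Uc Rc] mult_carrier_mat[OF Rc Ut]
  have "?B * ?B = ?B * (U * (R * U\<^sup>T))"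
    by (simp only: assoc_mult_mat[OF Uc Rc c(1)])
  also have "\<dots> = U * R * (U\<^sup>T * (U * (R * U\<^sup>T)))"
    by (rule assoc_mult_mat[OF c(2,1) mult_carrier_mat[OF Uc c(3)]])
  also have "\<dots> = U * (R * (R * U\<^sup>T))"
    by (simp only: orth_group_cancel(2)[OF U c(3)] assoc_mult_mat[OF Uc Rc c(3)])
  also have "\<dots> = U * ((R * R) * U\<^sup>T)"
    by (simp only: assoc_mult_mat[OF Rc Rc c(1)])
  also have "R * R = mat_diag n d"
    unfolding R_def mat_diag_diag using d by (auto simp: mat_diag_def)
  also have "U * (mat_diag n d * U\<^sup>T) = A * U * U\<^sup>T"
    unfolding AU using assoc_mult_mat[OF Uc mat_diag_dim, of "U\<^sup>T" n d] Uc by simp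
  also have "\<dots> = A" using Uc Ac orth_group_right[OF U] by simp
  finally have "?B * ?B = A" .
  moreover have "?B \<in> cov_mats n" by (unfold R_def, rule conj_mat_diag_cov[OF Uc]) (simp add: d)
  ultimately show ?thesis by blast
qed

lemma psd_sqrt_eqI:
  assumes "B \<in> cov_mats n" "B * B = A"
  shows "psd_sqrt A = B"
  unfolding psd_sqrt_def
proof (rule the_equality)
  have "dim_row A = n" using assms by (auto simp: cov_mats_def)
  then show "B \<in> cov_mats (dim_row A) \<and> B * B = A" using assms by simp
  show "C = B" if "C \<in> cov_mats (dim_row A) \<and> C * C = A" for C
    using that assms \<open>dim_row A = n\<close> cov_mats_square_inj by metis
qed

lemma psd_sqrt:
  assumes "A \<in> cov_mats n"
  shows "psd_sqrt A \<in> cov_mats n" "psd_sqrt A * psd_sqrt A = A"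
  using cov_mats_square_root_exists[OF assms] psd_sqrt_eqI by auto

lemma spd_mats_subset_cov_mats: "spd_mats k \<subseteq> cov_mats k"
proof
  fix D assume D: "D \<in> spd_mats k"
  have "v \<bullet> (D *\<^sub>v v) \<ge> 0" if "v \<in> carrier_vec k" for v
    using D that by (cases "v = 0\<^sub>v k") (force simp: spd_mats_def)+
  then show "D \<in> cov_mats k" using D by (simp add: spd_mats_def cov_mats_def)
qed

lemma spd_mats_psd_sqrt_inverse:
  assumes D: "D \<in> spd_mats k"
  obtains T where "T \<in> carrier_mat k k" "T * psd_sqrt D = 1\<^sub>m k" "psd_sqrt D * T = 1\<^sub>m k"
proof -
  let ?S = "psd_sqrt D"
  have S: "?S \<in> carrier_mat k k" "?S * ?S = D"
    using psd_sqrt[of D k] D spd_mats_subset_cov_mats by (auto simp: cov_mats_def)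
  have "v = 0\<^sub>v k" if v: "v \<in> carrier_vec k" "?S *\<^sub>v v = 0\<^sub>v k" for v
  proof -
    have "D *\<^sub>v v = ?S *\<^sub>v (?S *\<^sub>v v)"
      using assoc_mult_mat_vec[OF S(1) S(1) v(1)] S(2) by simp
    also have "\<dots> = 0\<^sub>v k" using S(1) by (auto simp: v(2))
    finally have "D *\<^sub>v v = 0\<^sub>v k" .
    then have "v \<bullet> (D *\<^sub>v v) = 0" using v by simp
    then show ?thesis using D v by (auto simp: spd_mats_def)
  qed
  then have "det ?S \<noteq> 0" using det_0_iff_vec_prod_zero_field[OF S(1)] by auto
  from det_non_zero_imp_unit[OF S(1) this] show thesis
    using that by (auto simp: Units_def ring_mat_def)
qed

section \<open>Column spaces, rank and Gram matrices\<close>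

lemma vec_space_col_space_image:
  fixes A :: "real mat"
  assumes A: "A \<in> carrier_mat n m"
  shows "vec_space.col_space n A = (\<lambda>v. A *\<^sub>v v) ` carrier_vec m"
  unfolding vec_space.col_space_eq[OF A] using A by auto

lemma injective_mult_mat_vec_eqD:
  fixes B :: "real mat"
  assumes B: "B \<in> carrier_mat n l" and inj: "\<And>v. v \<in> carrier_vec l \<Longrightarrow> B *\<^sub>v v = 0\<^sub>v n \<Longrightarrow> v = 0\<^sub>v l"
    and v: "v \<in> carrier_vec l" "w \<in> carrier_vec l" and eq: "B *\<^sub>v v = B *\<^sub>v w"
  shows "v = w"
proof -
  have "B *\<^sub>v (v - w) = 0\<^sub>v n"
    using B v eq by (simp add: mult_minus_distrib_mat_vec[OF B])
  then have "v - w = 0\<^sub>v l" using inj v by simp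
  then show ?thesis using v by (auto simp: vec_eq_iff)
qed

text \<open>The rank is by definition the dimension of the column space, so it can be read off from any
  injective matrix with the same column space.\<close>
lemma rank_eqI:
  fixes B :: "real mat"
  assumes B: "B \<in> carrier_mat n l" and inj: "\<And>v. v \<in> carrier_vec l \<Longrightarrow> B *\<^sub>v v = 0\<^sub>v n \<Longrightarrow> v = 0\<^sub>v l"
    and eq: "vec_space.col_space n M = vec_space.col_space n B"
  shows "vec_space.rank n M = l"
proof -
  interpret vec_space "TYPE(real)" n .
  have "distinct (cols B)"
    unfolding distinct_conv_nth
  proof (intro allI impI)
    fix i j assume ij: "i < length (cols B)" "j < length (cols B)" "i \<noteq> j"
    then have ij': "i < l" "j < l" using B by auto
    have "B *\<^sub>v unit_vec l i = cols B ! i" if "i < l" for i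
      using that B by (auto intro!: eq_vecI)
    then show "cols B ! i \<noteq> cols B ! j"
      using injective_mult_mat_vec_eqD[OF B inj, of "unit_vec l i" "unit_vec l j"] ij' ij(3) by auto
  qed
  moreover have "lin_indpt (set (cols B))"
    using lin_depE[OF B _ calculation] inj by metis
  ultimately have "rank B = l" using lin_indpt_full_rank[OF B] by simp
  moreover have "rank M = rank B"
    using eq unfolding rank_def col_space_def by simp
  ultimately show ?thesis by simp
qed

lemma col_space_mult_subset:
  fixes A :: "real mat"
  assumes "A \<in> carrier_mat n m" "B \<in> carrier_mat m p"
  shows "vec_space.col_space n (A * B) \<subseteq> vec_space.col_space n A"
  using assms by (auto simp: vec_space_col_space_image[of _ n m] vec_space_col_space_image[of _ n p] assoc_mult_mat_vec[of _ n m _ p])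

lemma col_space_mult_right_inverse:
  fixes A :: "real mat"
  assumes A: "A \<in> carrier_mat n m" and B: "B \<in> carrier_mat m p" and C: "C \<in> carrier_mat p m"
    and BC: "B * C = 1\<^sub>m m"
  shows "vec_space.col_space n (A * B) = vec_space.col_space n A"
proof -
  have "A = A * B * C" using A BC assoc_mult_mat[OF A B C] by simp
  then show ?thesis
    using col_space_mult_subset[OF A B] col_space_mult_subset[OF mult_carrier_mat[OF A B] C] by auto
qed

lemma col_space_drop_zero_columns:
  fixes N :: "real mat"
  assumes N: "N \<in> carrier_mat n k" and lk: "l \<le> k"
    and zero: "\<And>i j. i < n \<Longrightarrow> l \<le> j \<Longrightarrow> j < k \<Longrightarrow> N $$ (i,j) = 0"
  shows "vec_space.col_space n N = vec_space.col_space n (Matrix.mat n l (\<lambda>(i,j). N $$ (i,j)))"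
proof -
  let ?B = "Matrix.mat n l (\<lambda>(i,j). N $$ (i,j))"
  have eq: "N *\<^sub>v v = ?B *\<^sub>v w" if v: "v \<in> carrier_vec k" "w \<in> carrier_vec l"
    and vw: "\<And>j. j < l \<Longrightarrow> v $ j = w $ j" for v w
  proof (rule eq_vecI)
    fix i assume "i < dim_vec (?B *\<^sub>v w)"
    then have i: "i < n" by simp
    have "(N *\<^sub>v v) $ i = (\<Sum>j<k. N $$ (i,j) * v $ j)"
      using i v N by (simp add: scalar_prod_def atLeast0LessThan)
    also have "\<dots> = (\<Sum>j<l. N $$ (i,j) * w $ j)"
      using lk zero[OF i] vw by (intro sum.mono_neutral_cong_right) auto
    also have "\<dots> = (?B *\<^sub>v w) $ i"
      using i v by (simp add: scalar_prod_def atLeast0LessThan)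
    finally show "(N *\<^sub>v v) $ i = (?B *\<^sub>v w) $ i" .
  qed (use N in simp)
  have "N *\<^sub>v v \<in> (\<lambda>v. ?B *\<^sub>v v) ` carrier_vec l" if "v \<in> carrier_vec k" for v
    using that lk by (intro image_eqI[where x = "Matrix.vec l (\<lambda>j. v $ j)"] eq) auto
  moreover have "?B *\<^sub>v w \<in> (\<lambda>v. N *\<^sub>v v) ` carrier_vec k" if "w \<in> carrier_vec l" for w
    using that lk by (intro image_eqI[where x = "Matrix.vec k (\<lambda>j. if j < l then w $ j else 0)"] eq[symmetric]) auto
  moreover have Bc: "?B \<in> carrier_mat n l" by simp
  ultimately show ?thesis
    unfolding vec_space_col_space_image[OF N] vec_space_col_space_image[OF Bc] by blast
qed

lemma gram_entry:
  assumes "N \<in> carrier_mat m k" "i < k" "j < k"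
  shows "(N\<^sup>T * N) $$ (i,j) = col N i \<bullet> col N j"
  using assms by simp

text \<open>An eigenbasis \<open>V\<close> of the Gram matrix \<open>M\<^sup>T M\<close> is mapped by \<open>M\<close> to pairwise orthogonal vectors
  whose squared lengths are the eigenvalues.  Rank, singular values and singular vectors of \<open>M\<close>
  are all derived from this fact.\<close>
lemma gram_eigenbasis_cols:
  fixes M :: "real mat"
  assumes M: "M \<in> carrier_mat m k" and V: "V \<in> orth_group k"
    and MV: "(M\<^sup>T * M) * V = V * mat_diag k d" and ij: "i < k" "j < k"
  shows "col (M * V) i \<bullet> col (M * V) j = (if i = j then d j else 0)"
proof -
  have Vc: "V \<in> carrier_mat k k" using V by (rule orth_group_carrier)
  have MVc: "M * V \<in> carrier_mat m k" using M Vc by simp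
  have "(M * V)\<^sup>T * (M * V) = V\<^sup>T * ((M\<^sup>T * M) * V)"
    using M Vc by (simp add: transpose_mult[OF M Vc] assoc_mult_mat[of _ k k _ m _ k] assoc_mult_mat[of _ k m _ k _ k]
      mult_carrier_mat[of _ m k _ k] mult_carrier_mat[of _ k m _ k])
  also have "\<dots> = mat_diag k d"
    unfolding MV using orth_group_cancel(2)[OF V, of "mat_diag k d" k] by simp
  finally have "((M * V)\<^sup>T * (M * V)) $$ (i,j) = mat_diag k d $$ (i,j)" by simp
  moreover have "((M * V)\<^sup>T * (M * V)) $$ (i,j) = col (M * V) i \<bullet> col (M * V) j"
    by (rule gram_entry[OF MVc ij])
  ultimately show ?thesis using ij by (simp add: mat_diag_def)
qed

lemma gram_eigenbasis_zero_entry: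
  fixes M :: "real mat"
  assumes M: "M \<in> carrier_mat m k" and V: "V \<in> orth_group k"
    and MV: "(M\<^sup>T * M) * V = V * mat_diag k d" and i: "i < m" and j: "j < k" "d j = 0"
  shows "(M * V) $$ (i,j) = 0"
proof -
  have MVc: "M * V \<in> carrier_mat m k" using M orth_group_carrier[OF V] by simp
  have "col (M * V) j \<bullet> col (M * V) j = 0" using gram_eigenbasis_cols[OF M V MV j(1) j(1)] j(2) by simp
  then have "col (M * V) j = 0\<^sub>v m"
    using scalar_prod_self_eq_0[of "col (M * V) j" m] MVc j(1) by (simp del: col_mult col_mult2)
  then have "col (M * V) j $ i = 0" using i by simp
  moreover have "(M * V) $$ (i,j) = col (M * V) j $ i"
    by (rule index_col[symmetric]) (use carrier_matD[OF MVc] i j in simp_all)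
  ultimately show ?thesis by simp
qed

text \<open>The columns of \<open>M V\<close> for zero eigenvalues vanish, and the other columns are nonzero and orthogonal;
  so the first \<open>l\<close> columns of \<open>M V\<close> form a basis of the column space of \<open>M\<close>.\<close>
lemma column_basis_from_gram:
  fixes M :: "real mat"
  assumes M: "M \<in> carrier_mat m k" and V: "V \<in> orth_group k"
    and MV: "(M\<^sup>T * M) * V = V * mat_diag k d" and l: "l \<le> k"
    and nz: "\<And>i. i < l \<Longrightarrow> d i \<noteq> 0" and z: "\<And>i. l \<le> i \<Longrightarrow> i < k \<Longrightarrow> d i = 0"
  obtains B where "B \<in> carrier_mat m l"
    "\<And>v. v \<in> carrier_vec l \<Longrightarrow> B *\<^sub>v v = 0\<^sub>v m \<Longrightarrow> v = 0\<^sub>v l"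
    "vec_space.col_space m M = vec_space.col_space m B"
proof -
  have Vc: "V \<in> carrier_mat k k" using V by (rule orth_group_carrier)
  define N where "N = M * V"
  have Nc: "N \<in> carrier_mat m k" using M Vc by (simp add: N_def)
  define B where "B = Matrix.mat m l (\<lambda>(i,j). N $$ (i,j))"
  have Bc: "B \<in> carrier_mat m l" by (simp add: B_def)
  have colB: "col B j = col N j" if "j < l" for j
    using that l Nc by (auto simp: B_def intro!: eq_vecI)
  have "vec_space.col_space m M = vec_space.col_space m N"
    unfolding N_def using col_space_mult_right_inverse[OF M Vc _ orth_group_right[OF V]] Vc by simp
  also have "\<dots> = vec_space.col_space m B"
    unfolding B_def using gram_eigenbasis_zero_entry[OF M V MV] z
    by (intro col_space_drop_zero_columns[OF Nc l]) (simp add: N_def)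
  finally have "vec_space.col_space m M = vec_space.col_space m B" .
  moreover have "v = 0\<^sub>v l" if v: "v \<in> carrier_vec l" "B *\<^sub>v v = 0\<^sub>v m" for v
  proof (rule eq_vecI)
    fix i assume "i < dim_vec (0\<^sub>v l)"
    then have i: "i < l" by simp
    \<comment> \<open>The Gram matrix of \<open>B\<close> is diagonal without zeros, so \<open>B\<close> is injective.\<close>
    have BB: "B\<^sup>T * B = mat_diag l d"
      using gram_eigenbasis_cols[OF M V MV] l Bc colB
      by (auto simp: mat_diag_def N_def intro!: eq_matI)
    have "0 = (B\<^sup>T *\<^sub>v (B *\<^sub>v v)) $ i" using v i Bc by simp
    also have "\<dots> = (mat_diag l d *\<^sub>v v) $ i"
      using assoc_mult_mat_vec[of "B\<^sup>T" l m B l v] Bc v BB by simp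
    also have "\<dots> = d i * v $ i" using i by (simp add: mat_diag_mult_vec[OF v(1)])
    finally show "v $ i = 0\<^sub>v l $ i" using nz[OF i] i by simp
  qed (use v in simp)
  ultimately show thesis using that Bc by blast
qed

lemma gram_spectral:
  fixes M :: "real mat"
  assumes M: "M \<in> carrier_mat m k"
  obtains V d where "V \<in> orth_group k" "(M\<^sup>T * M) * V = V * mat_diag k d"
    "vec_space.rank m M \<le> k"
    "\<And>i. i < vec_space.rank m M \<Longrightarrow> d i > 0"
    "\<And>i. vec_space.rank m M \<le> i \<Longrightarrow> i < k \<Longrightarrow> d i = 0"
proof -
  have G: "M\<^sup>T * M \<in> carrier_mat k k" "(M\<^sup>T * M)\<^sup>T = M\<^sup>T * M"
    using M by (auto simp: transpose_mult[of _ k m _ k])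
  obtain V d l where V: "V \<in> orth_group k" and MV: "(M\<^sup>T * M) * V = V * mat_diag k d" and l: "l \<le> k"
    and nz: "\<And>i. i < l \<Longrightarrow> d i \<noteq> 0" and z: "\<And>i. l \<le> i \<Longrightarrow> i < k \<Longrightarrow> d i = 0"
    using spectral_theorem_zeros_last[OF G] by metis
  obtain B where "B \<in> carrier_mat m l"
    "\<And>v. v \<in> carrier_vec l \<Longrightarrow> B *\<^sub>v v = 0\<^sub>v m \<Longrightarrow> v = 0\<^sub>v l"
    "vec_space.col_space m M = vec_space.col_space m B"
    using column_basis_from_gram[OF M V MV l nz z] by metis
  then have rank: "vec_space.rank m M = l" by (rule rank_eqI)
  have "d i \<ge> 0" if "i < k" for i
    using gram_eigenbasis_cols[OF M V MV that that] scalar_prod_self_nonneg[of "col (M * V) i"] by simp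
  then have "d i > 0" if "i < l" for i using nz[OF that] l that by (metis le_neq_trans less_le_trans)
  then show thesis using that V MV l z rank by blast
qed

text \<open>Multiplication from the left changes the column space, but carries the injective basis matrix
  of \<open>M\<close> to an injective basis matrix of \<open>S M\<close>.\<close>
lemma rank_mult_left_inverse:
  fixes M :: "real mat"
  assumes M: "M \<in> carrier_mat m k" and S: "S \<in> carrier_mat p m" and T: "T \<in> carrier_mat m p"
    and TS: "T * S = 1\<^sub>m m"
  shows "vec_space.rank p (S * M) = vec_space.rank m M"
proof -
  obtain V d where V: "V \<in> orth_group k" and MV: "(M\<^sup>T * M) * V = V * mat_diag k d"
    and l: "vec_space.rank m M \<le> k" "\<And>i. i < vec_space.rank m M \<Longrightarrow> d i > 0"
    "\<And>i. vec_space.rank m M \<le> i \<Longrightarrow> i < k \<Longrightarrow> d i = 0"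
    using gram_spectral[OF M] by metis
  let ?l = "vec_space.rank m M"
  have nz: "d i \<noteq> 0" if "i < ?l" for i using l(2)[OF that] by simp
  obtain B where B: "B \<in> carrier_mat m ?l"
    "\<And>v. v \<in> carrier_vec ?l \<Longrightarrow> B *\<^sub>v v = 0\<^sub>v m \<Longrightarrow> v = 0\<^sub>v ?l"
    "vec_space.col_space m M = vec_space.col_space m B"
    using column_basis_from_gram[OF M V MV l(1) nz l(3)] by metis
  have img: "vec_space.col_space p (S * A) = (\<lambda>x. S *\<^sub>v x) ` vec_space.col_space m A"
    if "A \<in> carrier_mat m q" for A q
    using that S by (auto simp: vec_space_col_space_image[of _ m q] vec_space_col_space_image[of _ p q]
        image_image assoc_mult_mat_vec[of _ p m _ q] intro!: image_cong)
  have "v = 0\<^sub>v ?l" if v: "v \<in> carrier_vec ?l" "(S * B) *\<^sub>v v = 0\<^sub>v p" for v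
  proof -
    have Bv: "B *\<^sub>v v \<in> carrier_vec m" using B(1) v by simp
    have "B *\<^sub>v v = T *\<^sub>v (S *\<^sub>v (B *\<^sub>v v))"
      using assoc_mult_mat_vec[OF T S Bv] TS Bv by simp
    also have "\<dots> = 0\<^sub>v m" using v(2) assoc_mult_mat_vec[OF S B(1) v(1)] T by auto
    finally show ?thesis using B(2) v by simp
  qed
  then show ?thesis
    using B(1) S by (intro rank_eqI[of "S * B"]) (auto simp: img[OF M] img[OF B(1)] B(3))
qed

section \<open>Singular value decomposition\<close>

text \<open>The Gram matrix \<open>Q Q\<^sup>T\<close> of \<open>Q\<^sup>T\<close> is the projection to the span of \<open>Q\<close>.  It has rank \<open>l\<close>, so
  exactly \<open>n - l\<close> vectors of an orthonormal eigenbasis belong to the eigenvalue zero; these are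
  orthogonal to the columns of \<open>Q\<close> and complete them.\<close>
lemma stiefel_completion:
  assumes Q: "Q \<in> stiefel n l"
  obtains U where "U \<in> orth_group n" "l \<le> n"
    "\<And>i j. i < n \<Longrightarrow> j < l \<Longrightarrow> U $$ (i,j) = Q $$ (i,j)"
proof -
  have Qc: "Q \<in> carrier_mat n l" and QQ: "Q\<^sup>T * Q = 1\<^sub>m l" using Q by (auto simp: stiefel_def)
  have Qt: "Q\<^sup>T \<in> carrier_mat l n" using Qc by simp
  have "vec_space.col_space l (1\<^sub>m l * Q\<^sup>T) = vec_space.col_space l (1\<^sub>m l)"
    by (rule col_space_mult_right_inverse[OF one_carrier_mat Qt Qc QQ])
  then have rank: "vec_space.rank l (Q\<^sup>T) = l"
    using Qt by (intro rank_eqI[of "1\<^sub>m l"]) auto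
  obtain V d where V: "V \<in> orth_group n" and QV: "((Q\<^sup>T)\<^sup>T * Q\<^sup>T) * V = V * mat_diag n d"
    and l: "l \<le> n" and z: "\<And>i. l \<le> i \<Longrightarrow> i < n \<Longrightarrow> d i = 0"
    using gram_spectral[OF Qt] unfolding rank by metis
  have Vc: "V \<in> carrier_mat n n" using V by (rule orth_group_carrier)
  have perp: "col Q i \<bullet> col V j = 0" if "i < l" "l \<le> j" "j < n" for i j
    using gram_eigenbasis_zero_entry[OF Qt V QV that(1,3) z[OF that(2,3)]] that Qc Vc by simp
  define U where "U = Matrix.mat n n (\<lambda>(i,j). if j < l then Q $$ (i,j) else V $$ (i,j))"
  have Uc: "U \<in> carrier_mat n n" by (simp add: U_def)
  have colU: "col U j = (if j < l then col Q j else col V j)" if "j < n" for j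
    using that l Qc Vc by (auto simp: U_def intro!: eq_vecI)
  have "U \<in> stiefel n n"
  proof (rule stiefelI[OF Uc])
    fix i j assume ij: "i < n" "j < n"
    have "col V i \<bullet> col Q j = col Q j \<bullet> col V i" if "j < l"
      using that ij Qc Vc by (intro comm_scalar_prod[of _ n]) auto
    then show "col U i \<bullet> col U j = (if i = j then 1 else 0)"
      using ij colU perp stiefel_col_scalar_prod[OF Q]
        stiefel_col_scalar_prod[OF V[unfolded orth_group_eq_stiefel]] by auto
  qed
  moreover have "U $$ (i,j) = Q $$ (i,j)" if "i < n" "j < l" for i j
    using that l by (simp add: U_def)
  ultimately show thesis using that l by (simp add: orth_group_eq_stiefel)
qed

text \<open>The left singular vectors for nonzero singular values are the normalised images \<open>M v\<^sub>i / s\<^sub>i\<close>; the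
  others are any orthonormal completion, since there both sides of the equation vanish.\<close>
lemma singular_value_decomposition:
  fixes M :: "real mat"
  assumes M: "M \<in> carrier_mat k k"
  obtains U V s where "U \<in> orth_group k" "V \<in> orth_group k" "M * V = U * mat_diag k s"
    "vec_space.rank k M \<le> k" "\<And>i. i < vec_space.rank k M \<Longrightarrow> s i > 0"
    "\<And>i. vec_space.rank k M \<le> i \<Longrightarrow> i < k \<Longrightarrow> s i = 0"
proof -
  let ?l = "vec_space.rank k M"
  obtain V d where V: "V \<in> orth_group k" and MV: "(M\<^sup>T * M) * V = V * mat_diag k d"
    and l: "?l \<le> k" and pos: "\<And>i. i < ?l \<Longrightarrow> d i > 0"
    and z: "\<And>i. ?l \<le> i \<Longrightarrow> i < k \<Longrightarrow> d i = 0"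
    using gram_spectral[OF M] by metis
  have Vc: "V \<in> carrier_mat k k" using V by (rule orth_group_carrier)
  define N where "N = M * V"
  have N: "N \<in> carrier_mat k k" using M Vc by (simp add: N_def)
  define s where "s i = sqrt (d i)" for i
  have spos: "s i > 0" if "i < ?l" for i using pos[OF that] by (simp add: s_def)
  define Q where "Q = Matrix.mat k ?l (\<lambda>(i,j). N $$ (i,j) / s j)"
  have colQ: "col Q j = (1 / s j) \<cdot>\<^sub>v col N j" if "j < ?l" for j
    using that l N by (auto simp: Q_def intro!: eq_vecI)
  have "Q \<in> stiefel k ?l"
  proof (rule stiefelI)
    fix i j assume ij: "i < ?l" "j < ?l"
    then have "col N i \<in> carrier_vec k" "col N j \<in> carrier_vec k" using N l by auto
    then have "col Q i \<bullet> col Q j = (col N i \<bullet> col N j) / (s i * s j)"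
      using ij by (simp add: colQ)
    also have "col N i \<bullet> col N j = (if i = j then d j else 0)"
      unfolding N_def using gram_eigenbasis_cols[OF M V MV] ij l by simp
    finally show "col Q i \<bullet> col Q j = (if i = j then 1 else 0)"
      using pos[OF ij(2)] by (auto simp: s_def)
  qed (simp add: Q_def)
  then obtain U where U: "U \<in> orth_group k"
    and UQ: "\<And>i j. i < k \<Longrightarrow> j < ?l \<Longrightarrow> U $$ (i,j) = Q $$ (i,j)"
    using stiefel_completion by metis
  have Uc: "U \<in> carrier_mat k k" using U by (rule orth_group_carrier)
  have "N = U * mat_diag k s"
    unfolding mat_diag_mult_right[OF Uc]
  proof (rule eq_matI)
    fix i j assume "i < dim_row (Matrix.mat k k (\<lambda>(i,j). U $$ (i,j) * s j))"
      "j < dim_col (Matrix.mat k k (\<lambda>(i,j). U $$ (i,j) * s j))"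
    then have ij: "i < k" "j < k" by auto
    show "N $$ (i,j) = Matrix.mat k k (\<lambda>(i,j). U $$ (i,j) * s j) $$ (i,j)"
    proof (cases "j < ?l")
      case True
      then show ?thesis using ij UQ spos[OF True] by (simp add: Q_def)
    next
      case False
      then show ?thesis using ij z[of j] gram_eigenbasis_zero_entry[OF M V MV ij]
        by (simp add: N_def s_def)
    qed
  qed (use N in auto)
  moreover have "s i = 0" if "?l \<le> i" "i < k" for i using z[OF that] by (simp add: s_def)
  ultimately show thesis using that U V l spos by (simp add: N_def)
qed

section \<open>Singular values and principal angles\<close>

lemma proots_prod_linear_factors: "proots (\<Prod>a\<leftarrow>as. [:- a, 1 :: real:]) = mset as"
proof (induction as)
  case (Cons a as)
  have "(\<Prod>a\<leftarrow>as. [:- a, 1 :: real:]) \<noteq> 0" by (auto simp: prod_list_zero_iff)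
  then show ?case using Cons by (simp add: proots_mult del: mult_pCons_left)
qed simp

lemma char_poly_orth_conj:
  assumes A: "A \<in> carrier_mat k k" and V: "V \<in> orth_group k" and B: "B \<in> carrier_mat k k"
    and AV: "A * V = V * B"
  shows "char_poly A = char_poly B"
proof -
  have Vc: "V \<in> carrier_mat k k" and Vt: "V\<^sup>T \<in> carrier_mat k k"
    using orth_group_carrier[OF V] by auto
  have "A = A * (V * V\<^sup>T)" using A orth_group_right[OF V] by simp
  also have "\<dots> = V * B * V\<^sup>T" using assoc_mult_mat[OF A Vc Vt] AV by simp
  finally have "similar_mat A B"
    using A B Vc orth_group_left[OF V] orth_group_right[OF V]
    unfolding similar_mat_def similar_mat_wit_def Let_def
    by (intro exI[of _ V] exI[of _ "V\<^sup>T"]) auto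
  then show ?thesis by (rule char_poly_similar)
qed

lemma singular_values_eq:
  assumes A: "A \<in> carrier_mat m k" and V: "V \<in> orth_group k"
    and AV: "(A\<^sup>T * A) * V = V * mat_diag k d"
  shows "singular_values A = mset (map (\<lambda>i. sqrt (d i)) [0..<k])"
proof -
  have "A\<^sup>T * A \<in> carrier_mat k k" using A by simp
  then have "char_poly (A\<^sup>T * A) = char_poly (mat_diag k d)"
    using char_poly_orth_conj[OF _ V _ AV] by simp
  also have "\<dots> = (\<Prod>a\<leftarrow>map d [0..<k]. [:- a, 1:])"
    by (subst char_poly_upper_triangular[of _ k]) (auto simp: mat_diag_def diag_mat_def intro!: arg_cong[of _ _ prod_list])
  finally show ?thesis
    by (simp add: singular_values_def proots_prod_linear_factors multiset.map_comp o_def del: map_map)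
qed

text \<open>Makes the singular values of \<open>Q1\<^sup>T Q2\<close> depend on the two column spaces only: changing orthonormal
  bases multiplies this matrix by orthogonal matrices on both sides.\<close>
lemma singular_values_orth_invariant:
  assumes A: "A \<in> carrier_mat k k" and P: "P \<in> orth_group k" and R: "R \<in> orth_group k"
  shows "singular_values (P\<^sup>T * (A * R)) = singular_values A"
proof -
  have c: "P \<in> carrier_mat k k" "P\<^sup>T \<in> carrier_mat k k" "R \<in> carrier_mat k k" "R\<^sup>T \<in> carrier_mat k k"
    "A\<^sup>T \<in> carrier_mat k k"
    using orth_group_carrier[OF P] orth_group_carrier[OF R] A by auto
  note m = mult_carrier_mat[of _ k k _ k] and a = assoc_mult_mat[of _ k k _ k _ k]
  let ?B = "P\<^sup>T * (A * R)"
  have B: "?B \<in> carrier_mat k k" using c A by (simp add: m)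
  have "?B\<^sup>T = (A * R)\<^sup>T * P"
    using transpose_mult[OF c(2) m[OF A c(3)]] by simp
  also have "\<dots> = R\<^sup>T * A\<^sup>T * P" using transpose_mult[OF A c(3)] by simp
  finally have "?B\<^sup>T * ?B = R\<^sup>T * (A\<^sup>T * (P * (P\<^sup>T * (A * R))))"
    using c A by (simp add: m a)
  also have "P * (P\<^sup>T * (A * R)) = A * R"
    by (rule orth_group_cancel(1)[OF P m[OF A c(3)]])
  finally have BB: "?B\<^sup>T * ?B = R\<^sup>T * (A\<^sup>T * A * R)" using c A by (simp add: m a)
  have AA: "A\<^sup>T * A \<in> carrier_mat k k" using c A by simp
  have "A\<^sup>T * A * R = R * (?B\<^sup>T * ?B)"
    unfolding BB by (rule orth_group_cancel(1)[OF R m[OF AA c(3)], symmetric])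
  then have "char_poly (A\<^sup>T * A) = char_poly (?B\<^sup>T * ?B)"
    using char_poly_orth_conj[OF AA R] B by simp
  then show ?thesis by (simp add: singular_values_def)
qed

text \<open>The matrix \<open>R = Q\<^sup>T Q'\<close> works because \<open>Q Q\<^sup>T\<close> fixes every vector in the span of \<open>Q\<close>.\<close>
lemma stiefel_same_col_space:
  assumes Q: "Q \<in> stiefel n k" and Q': "Q' \<in> stiefel n k"
    and eq: "vec_space.col_space n Q = vec_space.col_space n Q'"
  obtains R where "R \<in> orth_group k" "Q' = Q * R"
proof -
  have c: "Q \<in> carrier_mat n k" "Q\<^sup>T \<in> carrier_mat k n" "Q' \<in> carrier_mat n k" "Q'\<^sup>T \<in> carrier_mat k n"
    and QQ: "Q\<^sup>T * Q = 1\<^sub>m k" "Q'\<^sup>T * Q' = 1\<^sub>m k"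
    using Q Q' by (auto simp: stiefel_def)
  define R where "R = Q\<^sup>T * Q'"
  have R: "R \<in> carrier_mat k k" using c by (simp add: R_def)
  have proj: "Q' = Q * R"
  proof (rule mat_col_eqI)
    fix j assume "j < dim_col (Q * R)"
    then have j: "j < k" using R by simp
    have "col Q' j = Q' *\<^sub>v unit_vec k j" using c j by (auto intro!: eq_vecI)
    then have "col Q' j \<in> vec_space.col_space n Q'"
      unfolding vec_space_col_space_image[OF c(3)] by auto
    then obtain w where w: "w \<in> carrier_vec k" "col Q' j = Q *\<^sub>v w"
      unfolding eq[symmetric] vec_space_col_space_image[OF c(1)] by auto
    have "col (Q * R) j = Q *\<^sub>v (Q\<^sup>T *\<^sub>v col Q' j)"
      using col_mult2[OF c(1) R j] col_mult2[OF c(2,3) j] by (simp add: R_def)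
    also have "Q\<^sup>T *\<^sub>v col Q' j = w"
      unfolding w(2) using assoc_mult_mat_vec[OF c(2,1) w(1)] QQ(1) w(1) by simp
    finally show "col Q' j = col (Q * R) j" using w(2) by simp
  qed (use c R in auto)
  have Rt: "R\<^sup>T = Q'\<^sup>T * Q" using transpose_mult[OF c(2,3)] by (simp add: R_def)
  have "R\<^sup>T * R = Q'\<^sup>T * (Q * R)" unfolding Rt by (rule assoc_mult_mat[OF c(4,1) R])
  then have "R\<^sup>T * R = 1\<^sub>m k" using proj QQ(2) by simp
  then show thesis using that R proj by (simp add: orth_group_def)
qed

text \<open>The residual of the orthogonal projection \<open>p = Q Q\<^sup>T w\<close> has squared length
  \<open>w \<bullet> w - (Q\<^sup>T w) \<bullet> (Q\<^sup>T w)\<close>.\<close>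
lemma stiefel_transpose_contraction:
  assumes Q: "Q \<in> stiefel n k" and w: "w \<in> carrier_vec n"
  shows "(Q\<^sup>T *\<^sub>v w) \<bullet> (Q\<^sup>T *\<^sub>v w) \<le> w \<bullet> w"
proof -
  have c: "Q \<in> carrier_mat n k" "Q\<^sup>T \<in> carrier_mat k n" and QQ: "Q\<^sup>T * Q = 1\<^sub>m k"
    using Q by (auto simp: stiefel_def)
  define y p where "y = Q\<^sup>T *\<^sub>v w" and "p = Q *\<^sub>v y"
  have v: "y \<in> carrier_vec k" "p \<in> carrier_vec n" using c w by (auto simp: y_def p_def)
  have wp: "w \<bullet> p = y \<bullet> y"
    using transpose_vec_mult_scalar[OF c(1) v(1) w] by (simp add: y_def p_def)
  have "Q\<^sup>T *\<^sub>v p = y" unfolding p_def using assoc_mult_mat_vec[OF c(2,1) v(1)] QQ v(1) by simp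
  then have pp: "p \<bullet> p = y \<bullet> y"
    using transpose_vec_mult_scalar[OF c(1) v(1) v(2)] by (simp add: p_def)
  have "0 \<le> (w - p) \<bullet> (w - p)" by (rule scalar_prod_self_nonneg)
  also have "\<dots> = w \<bullet> w - y \<bullet> y"
    using w v wp pp comm_scalar_prod[OF v(2) w]
    by (simp add: minus_scalar_prod_distrib[of _ n] scalar_prod_minus_distrib[of _ n])
  finally show ?thesis by (simp add: y_def)
qed

text \<open>The bounds make every singular value the cosine of an angle in \<open>[0, \<pi>/2]\<close>.  They hold because
  \<open>Q1\<^sup>T\<close> does not increase length and \<open>Q2\<close> preserves it.\<close>
lemma singular_values_stiefel_product:
  assumes Q1: "Q1 \<in> stiefel n k" and Q2: "Q2 \<in> stiefel n k"
  obtains s where "singular_values (Q1\<^sup>T * Q2) = mset (map s [0..<k])"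
    "\<And>i. i < k \<Longrightarrow> 0 \<le> s i \<and> s i \<le> 1" "vec_space.rank k (Q1\<^sup>T * Q2) \<le> k"
    "\<And>i. i < k \<Longrightarrow> s i = 0 \<longleftrightarrow> vec_space.rank k (Q1\<^sup>T * Q2) \<le> i"
proof -
  have c: "Q1 \<in> carrier_mat n k" "Q1\<^sup>T \<in> carrier_mat k n" "Q2 \<in> carrier_mat n k"
    using Q1 Q2 by (auto simp: stiefel_def)
  define A where "A = Q1\<^sup>T * Q2"
  have A: "A \<in> carrier_mat k k" using c by (simp add: A_def)
  obtain V d where V: "V \<in> orth_group k" and AV: "(A\<^sup>T * A) * V = V * mat_diag k d"
    and l: "vec_space.rank k A \<le> k" and pos: "\<And>i. i < vec_space.rank k A \<Longrightarrow> d i > 0"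
    and z: "\<And>i. vec_space.rank k A \<le> i \<Longrightarrow> i < k \<Longrightarrow> d i = 0"
    using gram_spectral[OF A] by metis
  have Vc: "V \<in> carrier_mat k k" using V by (rule orth_group_carrier)
  have d: "0 \<le> d i" "d i \<le> 1" if i: "i < k" for i
  proof -
    have Q2V: "Q2 * V \<in> stiefel n k"
      using stiefel_mult[OF Q2] V by (simp add: orth_group_eq_stiefel)
    have "A * V = Q1\<^sup>T * (Q2 * V)" unfolding A_def by (rule assoc_mult_mat[OF c(2,3) Vc])
    then have "col (A * V) i = Q1\<^sup>T *\<^sub>v col (Q2 * V) i"
      using col_mult2[OF c(2) stiefel_carrier[OF Q2V] i] by metis
    moreover have "col (Q2 * V) i \<in> carrier_vec n" using stiefel_carrier[OF Q2V] i by (metis col_carrier_vec)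
    ultimately have "col (A * V) i \<bullet> col (A * V) i \<le> col (Q2 * V) i \<bullet> col (Q2 * V) i"
      using stiefel_transpose_contraction[OF Q1] by metis
    also have "\<dots> = 1" using stiefel_col_scalar_prod[OF Q2V i i] by simp
    finally show "d i \<le> 1" using gram_eigenbasis_cols[OF A V AV i i] by simp
    show "0 \<le> d i"
      using gram_eigenbasis_cols[OF A V AV i i] scalar_prod_self_nonneg[of "col (A * V) i"] by simp
  qed
  show thesis
  proof (rule that[of "\<lambda>i. sqrt (d i)"]; (fold A_def)?)
    show "singular_values A = mset (map (\<lambda>i. sqrt (d i)) [0..<k])"
      by (rule singular_values_eq[OF A V AV])
    show "0 \<le> sqrt (d i) \<and> sqrt (d i) \<le> 1" if "i < k" for i using d[OF that] by simp
    show "sqrt (d i) = 0 \<longleftrightarrow> vec_space.rank k A \<le> i" if "i < k" for i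
      using pos[of i] z[of i] that by (cases "vec_space.rank k A \<le> i") auto
  qed (rule l)
qed

text \<open>Shows that the definite description of the principal angles is well-defined and eliminates it.
  Existence: sort the arccosines of the singular values, which lie in \<open>[0,1]\<close>.  Uniqueness: the
  multiset of cosines does not depend on the chosen bases, and the cosine is injective on the
  allowed range, so the angles are determined as a multiset and hence as a sorted list.\<close>
lemma principal_angles_stiefel:
  assumes Q1: "Q1 \<in> stiefel n k" and Q2: "Q2 \<in> stiefel n k"
  defines "\<theta>s \<equiv> principal_angles n k (vec_space.col_space n Q1) (vec_space.col_space n Q2)"
  shows "length \<theta>s = k" "set \<theta>s \<subseteq> {0..pi / 2}"
    "singular_values (Q1\<^sup>T * Q2) = mset (map cos \<theta>s)"
proof -
  define angles where "angles \<theta>s \<longleftrightarrow> length \<theta>s = k \<and> sorted \<theta>s \<and> set \<theta>s \<subseteq> {0..pi / 2} \<and>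
    singular_values (Q1\<^sup>T * Q2) = mset (map cos \<theta>s)" for \<theta>s
  obtain s where s: "singular_values (Q1\<^sup>T * Q2) = mset (map s [0..<k])"
    "\<And>i. i < k \<Longrightarrow> 0 \<le> s i \<and> s i \<le> 1"
    using singular_values_stiefel_product[OF Q1 Q2] by metis
  define ts where "ts = sort (map (\<lambda>i. arccos (s i)) [0..<k])"
  have "cos (arccos (s i)) = s i" if "i < k" for i
    using s(2)[OF that] by (intro cos_arccos) auto
  then have "map (\<lambda>i. cos (arccos (s i))) [0..<k] = map s [0..<k]" by simp
  then have "mset (map (\<lambda>i. cos (arccos (s i))) [0..<k]) = mset (map s [0..<k])" by (simp only:)
  then have "mset (map cos ts) = mset (map s [0..<k])"
    by (simp add: ts_def multiset.map_comp o_def)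
  moreover have "arccos (s i) \<in> {0..pi / 2}" if "i < k" for i
    using s(2)[OF that] arccos_le_pi2[of "s i"] arccos_lbound[of "s i"] by auto
  ultimately have ts: "angles ts" unfolding angles_def s(1) by (auto simp: ts_def)
  have uniq: "xs = ts" if "angles xs" for xs
  proof -
    have inv: "image_mset arccos (mset (map cos xs)) = mset xs" if "angles xs" for xs
    proof -
      have "set xs \<subseteq> {0..pi / 2}" using that unfolding angles_def by blast
      then have "0 \<le> x \<and> x \<le> pi / 2" if "x \<in> set xs" for x using that by auto
      then have "arccos (cos x) = x" if "x \<in> set xs" for x
        using that pi_ge_zero by (intro arccos_cos) fastforce+
      then have "map (\<lambda>x. arccos (cos x)) xs = xs" by (rule map_idI)
      then show ?thesis by (simp only: mset_map[symmetric] map_map o_def)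
    qed
    have sv: "singular_values (Q1\<^sup>T * Q2) = mset (map cos xs)" "sorted xs" if "angles xs" for xs
      using that unfolding angles_def by blast+
    have "mset (map cos xs) = mset (map cos ts)"
      by (rule trans[OF sv(1)[OF that, symmetric] sv(1)[OF ts]])
    then have "mset xs = mset ts" using inv[OF ts] inv[OF that] by simp
    then have "sort ts = xs" using sv(2)[OF that] by (rule properties_for_sort)
    then show ?thesis using sorted_sort_id[OF sv(2)[OF ts]] by simp
  qed
  \<comment> \<open>The bases quantified in the definition may be replaced by the given ones.\<close>
  have "(\<exists>Q1' \<in> stiefel n k. \<exists>Q2' \<in> stiefel n k.
      vec_space.col_space n Q1 = vec_space.col_space n Q1' \<and>
      vec_space.col_space n Q2 = vec_space.col_space n Q2' \<and>
      singular_values (Q1'\<^sup>T * Q2') = S) \<longleftrightarrow> singular_values (Q1\<^sup>T * Q2) = S" (is "?L S \<longleftrightarrow> ?R S") for S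
  proof
    assume "?L S"
    then obtain Q1' Q2' where Q': "Q1' \<in> stiefel n k" "Q2' \<in> stiefel n k"
      and eq: "vec_space.col_space n Q1 = vec_space.col_space n Q1'"
        "vec_space.col_space n Q2 = vec_space.col_space n Q2'"
      and S: "singular_values (Q1'\<^sup>T * Q2') = S" by blast
    obtain P where P: "P \<in> orth_group k" "Q1' = Q1 * P"
      using stiefel_same_col_space[OF Q1 Q'(1) eq(1)] by metis
    obtain R where R: "R \<in> orth_group k" "Q2' = Q2 * R"
      using stiefel_same_col_space[OF Q2 Q'(2) eq(2)] by metis
    have c: "Q1 \<in> carrier_mat n k" "Q1\<^sup>T \<in> carrier_mat k n" "Q2 \<in> carrier_mat n k"
      "P \<in> carrier_mat k k" "P\<^sup>T \<in> carrier_mat k k" "R \<in> carrier_mat k k"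
      using Q1 Q2 P R by (auto simp: stiefel_def orth_group_def)
    have A: "Q1\<^sup>T * Q2 \<in> carrier_mat k k" using c by simp
    have "Q1'\<^sup>T * Q2' = P\<^sup>T * Q1\<^sup>T * (Q2 * R)" by (simp only: P R transpose_mult[OF c(1,4)])
    also have "\<dots> = P\<^sup>T * (Q1\<^sup>T * (Q2 * R))"
      by (rule assoc_mult_mat[OF c(5,2) mult_carrier_mat[OF c(3,6)]])
    also have "\<dots> = P\<^sup>T * (Q1\<^sup>T * Q2 * R)" by (simp only: assoc_mult_mat[OF c(2,3,6)])
    finally show "?R S" using S singular_values_orth_invariant[OF A P(1) R(1)] by simp
  qed (use Q1 Q2 in blast)
  then have "\<theta>s = (THE \<theta>s. angles \<theta>s)"
    unfolding \<theta>s_def principal_angles_def angles_def by (simp only:)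
  also have "\<dots> = ts" using ts uniq by (rule the_equality)
  finally show "length \<theta>s = k" "set \<theta>s \<subseteq> {0..pi / 2}"
    "singular_values (Q1\<^sup>T * Q2) = mset (map cos \<theta>s)"
    using ts unfolding angles_def by auto
qed

lemma card_right_principal_angles:
  assumes Q1: "Q1 \<in> stiefel n k" and Q2: "Q2 \<in> stiefel n k"
  defines "\<theta>s \<equiv> principal_angles n k (vec_space.col_space n Q1) (vec_space.col_space n Q2)"
  shows "card {i. i < k \<and> \<theta>s ! i = pi / 2} = k - vec_space.rank k (Q1\<^sup>T * Q2)"
proof -
  let ?l = "vec_space.rank k (Q1\<^sup>T * Q2)"
  note \<theta> = principal_angles_stiefel[OF Q1 Q2, folded \<theta>s_def]
  obtain s where s: "singular_values (Q1\<^sup>T * Q2) = mset (map s [0..<k])"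
    "\<And>i. i < k \<Longrightarrow> s i = 0 \<longleftrightarrow> ?l \<le> i"
    using singular_values_stiefel_product[OF Q1 Q2] by metis
  have cos0: "cos x = 0 \<longleftrightarrow> x = pi / 2" if x: "x \<in> set \<theta>s" for x
  proof
    assume "cos x = 0"
    have "0 \<le> x \<and> x \<le> pi / 2" using \<theta>(2) x by auto
    then have "arccos (cos x) = x" using pi_ge_zero by (intro arccos_cos) linarith+
    then show "x = pi / 2" unfolding \<open>cos x = 0\<close> by simp
  next
    assume "x = pi / 2"
    then show "cos x = 0" by (simp only: cos_pi_half)
  qed
  have count: "size (filter_mset (\<lambda>c. c = 0) (mset (map f xs))) = length (filter (\<lambda>x. f x = 0) xs)"
    for f :: "'b \<Rightarrow> real" and xs
    by (induction xs) auto
  have "card {i. i < k \<and> \<theta>s ! i = pi / 2} = length (filter (\<lambda>x. x = pi / 2) \<theta>s)"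
    by (simp add: length_filter_conv_card \<theta>(1))
  also have "filter (\<lambda>x. x = pi / 2) \<theta>s = filter (\<lambda>x. cos x = 0) \<theta>s"
    by (rule filter_cong[OF refl]) (simp only: cos0)
  also have "length \<dots> = size (filter_mset (\<lambda>c. c = 0) (mset (map cos \<theta>s)))"
    by (rule count[symmetric])
  also have "\<dots> = length (filter (\<lambda>i. s i = 0) [0..<k])"
    unfolding \<theta>(3)[symmetric] s(1) by (rule count)
  also have "\<dots> = card {i. i < k \<and> s i = 0}"
    by (simp add: length_filter_conv_card cong: conj_cong)
  also have "{i. i < k \<and> s i = 0} = {?l..<k}" using s(2) by auto
  finally show ?thesis by simp
qed

section \<open>Orthogonal factors that make a matrix positive semidefinite\<close>

text \<open>By symmetry \<open>M R = (M R)\<^sup>T\<close>, so \<open>(M R)\<^sup>2 = M R R\<^sup>T M\<^sup>T\<close>.\<close>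
lemma square_eq_gram_of_cov:
  assumes M: "M \<in> carrier_mat k k" and R: "R \<in> orth_group k" and MR: "M * R \<in> cov_mats k"
  shows "(M * R) * (M * R) = M * M\<^sup>T"
proof -
  have c: "R \<in> carrier_mat k k" "R\<^sup>T \<in> carrier_mat k k" "M\<^sup>T \<in> carrier_mat k k"
    using orth_group_carrier[OF R] M by auto
  have "M * R = R\<^sup>T * M\<^sup>T"
    using MR transpose_mult[OF M c(1)] by (simp add: cov_mats_def)
  then have "(M * R) * (M * R) = M * R * (R\<^sup>T * M\<^sup>T)" by simp
  also have "\<dots> = M * (R * (R\<^sup>T * M\<^sup>T))" by (rule assoc_mult_mat[OF M c(1) mult_carrier_mat[OF c(2,3)]])
  also have "\<dots> = M * M\<^sup>T" by (simp only: orth_group_cancel(1)[OF R c(3)])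
  finally show ?thesis .
qed

lemma mult_transpose_cov:
  assumes M: "(M :: real mat) \<in> carrier_mat k m"
  shows "M * M\<^sup>T \<in> cov_mats k"
  using conj_mat_diag_cov[OF M, of "\<lambda>_. 1"] M by simp

lemma cov_mult_orth_iff_psd_sqrt:
  assumes M: "M \<in> carrier_mat k k" and R: "R \<in> orth_group k"
  shows "M * R \<in> cov_mats k \<longleftrightarrow> M * R = psd_sqrt (M * M\<^sup>T)"
  using psd_sqrt_eqI[OF _ square_eq_gram_of_cov[OF M R]] psd_sqrt(1)[OF mult_transpose_cov[OF M]] by auto

definition block_embed :: "nat \<Rightarrow> nat \<Rightarrow> real mat \<Rightarrow> real mat" where
  "block_embed l m W = four_block_mat (1\<^sub>m l) (0\<^sub>m l m) (0\<^sub>m m l) W"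

text \<open>The equation forces the first \<open>l\<close> rows of \<open>W\<close> to be unit vectors.  The other rows are orthogonal
  to these, hence vanish in the first \<open>l\<close> columns, and what remains is an arbitrary orthogonal
  matrix of size \<open>k - l\<close>.\<close>
lemma orth_fixing_diagonal_iff:
  assumes l: "l \<le> k" and nz: "\<And>i. i < l \<Longrightarrow> s i \<noteq> 0" and z: "\<And>i. l \<le> i \<Longrightarrow> i < k \<Longrightarrow> s i = 0"
  shows "{W \<in> orth_group k. mat_diag k s * W = mat_diag k s} = block_embed l (k - l) ` orth_group (k - l)"
proof (rule equalityI; rule subsetI)
  fix W assume "W \<in> {W \<in> orth_group k. mat_diag k s * W = mat_diag k s}"
  then have W: "W \<in> orth_group k" and sW: "mat_diag k s * W = mat_diag k s" by auto
  have Wc: "W \<in> carrier_mat k k" using W by (rule orth_group_carrier)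
  have top: "W $$ (i,j) = (if i = j then 1 else 0)" if ij: "i < l" "j < k" for i j
  proof -
    have "(mat_diag k s * W) $$ (i,j) = mat_diag k s $$ (i,j)" by (simp only: sW)
    then show ?thesis
      unfolding mat_diag_mult_left[OF Wc] using ij l nz[OF ij(1)] by (auto simp: mat_diag_def split: if_splits)
  qed
  have left: "W $$ (i,j) = 0" if ij: "l \<le> i" "i < k" "j < l" for i j
  proof -
    have "col (W\<^sup>T) j = unit_vec k j"
      using top[of j] ij l Wc by (auto intro!: eq_vecI)
    moreover have "col (W\<^sup>T) i \<bullet> col (W\<^sup>T) j = 0"
      using stiefel_col_scalar_prod[of "W\<^sup>T" k k i j] orth_group_transpose[OF W] ij l
      by (simp add: orth_group_eq_stiefel)
    ultimately show ?thesis using ij l Wc by simp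
  qed
  define W' where "W' = Matrix.mat (k - l) (k - l) (\<lambda>(i,j). W $$ (l + i, l + j))"
  have W'c: "W' \<in> carrier_mat (k - l) (k - l)" by (simp add: W'_def)
  have Wb: "W = block_embed l (k - l) W'"
    unfolding block_embed_def using l Wc top left by (auto simp: W'_def intro!: eq_matI)
  have "W' \<in> orth_group (k - l)"
    unfolding orth_group_eq_stiefel
  proof (rule stiefelI[OF W'c])
    fix i j assume ij: "i < k - l" "j < k - l"
    have "col W' i \<bullet> col W' j = (\<Sum>a<k-l. W $$ (l + a, l + i) * W $$ (l + a, l + j))"
      using ij by (simp add: W'_def scalar_prod_def atLeast0LessThan)
    also have "\<dots> = (\<Sum>a\<in>{l..<k}. W $$ (a, l + i) * W $$ (a, l + j))"
      using l by (intro sum.reindex_bij_witness[of _ "\<lambda>a. a - l" "\<lambda>a. l + a"]) auto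
    also have "\<dots> = (\<Sum>a<k. W $$ (a, l + i) * W $$ (a, l + j))"
      using l top ij by (intro sum.mono_neutral_left) auto
    also have "\<dots> = col W (l + i) \<bullet> col W (l + j)"
      using ij Wc by (simp add: scalar_prod_def atLeast0LessThan)
    also have "\<dots> = (if i = j then 1 else 0)"
      using stiefel_col_scalar_prod[OF W[unfolded orth_group_eq_stiefel], of "l + i" "l + j"] ij by simp
    finally show "col W' i \<bullet> col W' j = (if i = j then 1 else 0)" .
  qed
  then show "W \<in> block_embed l (k - l) ` orth_group (k - l)" using Wb by blast
next
  fix W assume "W \<in> block_embed l (k - l) ` orth_group (k - l)"
  then obtain W' where W': "W' \<in> orth_group (k - l)" "W = block_embed l (k - l) W'" by blast
  have W: "W \<in> orth_group k"
    using orth_group_block[OF W'(1), of l] l W'(2) by (simp add: block_embed_def)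
  have W'c: "W' \<in> carrier_mat (k - l) (k - l)" using W'(1) by (rule orth_group_carrier)
  have "mat_diag k s * W = mat_diag k s"
    unfolding mat_diag_mult_left[OF orth_group_carrier[OF W]]
    using l z W'c by (auto simp: mat_diag_def W'(2) block_embed_def intro!: eq_matI)
  then show "W \<in> {W \<in> orth_group k. mat_diag k s * W = mat_diag k s}" using W by simp
qed

lemma block_embed_inj:
  "inj_on (block_embed l m) (orth_group m)"
proof (rule inj_onI)
  fix A B assume AB: "A \<in> orth_group m" "B \<in> orth_group m" and eq: "block_embed l m A = block_embed l m B"
  note c = AB[THEN orth_group_carrier]
  show "A = B"
  proof (rule eq_matI)
    fix i j assume ij: "i < dim_row B" "j < dim_col B"
    then show "A $$ (i,j) = B $$ (i,j)"
      using arg_cong[OF eq, of "\<lambda>W. W $$ (l + i, l + j)"] c by (simp add: block_embed_def)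
  qed (use carrier_matD[OF c(1)] carrier_matD[OF c(2)] in simp_all)
qed

lemma orth_group_mult_bij:
  assumes V: "V \<in> orth_group k" and U: "U \<in> orth_group k"
  shows "bij_betw (\<lambda>W. V * (W * U\<^sup>T)) (orth_group k) (orth_group k)"
proof (rule bij_betw_byWitness[of _ "\<lambda>R. V\<^sup>T * (R * U)"])
  note m = mult_carrier_mat[of _ k k _ k]
  have c: "V \<in> carrier_mat k k" "V\<^sup>T \<in> carrier_mat k k" "U \<in> carrier_mat k k" "U\<^sup>T \<in> carrier_mat k k"
    using V U by (auto simp: orth_group_def)
  show "\<forall>W\<in>orth_group k. V\<^sup>T * ((V * (W * U\<^sup>T)) * U) = W"
  proof
    fix W assume "W \<in> orth_group k"
    then have W: "W \<in> carrier_mat k k" by (rule orth_group_carrier)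
    have "V * (W * U\<^sup>T) * U = V * (W * (U\<^sup>T * U))"
      using assoc_mult_mat[OF c(1) m[OF W c(4)] c(3)] assoc_mult_mat[OF W c(4,3)] by simp
    then show "V\<^sup>T * ((V * (W * U\<^sup>T)) * U) = W"
      using orth_group_cancel(2)[OF V W] orth_group_left[OF U] W by simp
  qed
  show "\<forall>R\<in>orth_group k. V * ((V\<^sup>T * (R * U)) * U\<^sup>T) = R"
  proof
    fix R assume "R \<in> orth_group k"
    then have R: "R \<in> carrier_mat k k" by (rule orth_group_carrier)
    have "V\<^sup>T * (R * U) * U\<^sup>T = V\<^sup>T * (R * (U * U\<^sup>T))"
      using assoc_mult_mat[OF c(2) m[OF R c(3)] c(4)] assoc_mult_mat[OF R c(3,4)] by simp
    then show "V * ((V\<^sup>T * (R * U)) * U\<^sup>T) = R"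
      using orth_group_cancel(1)[OF V R] orth_group_right[OF U] R by simp
  qed
qed (use V U in \<open>auto intro!: orth_group_mult orth_group_transpose\<close>)

text \<open>Let \<open>M V = U S\<close> be a singular value decomposition and write \<open>R = V W U\<^sup>T\<close>.  Then
  \<open>M R = U (S W) U\<^sup>T\<close>.  For \<open>W = 1\<close> this is positive semidefinite, and every positive semidefinite
  \<open>M R\<close> equals the unique square root of \<open>M M\<^sup>T\<close>; so the condition on \<open>R\<close> becomes \<open>S W = S\<close>.\<close>
lemma cov_mult_orth_bij:
  assumes M: "M \<in> carrier_mat k k"
  shows "\<exists>f. bij_betw f (orth_group (k - vec_space.rank k M)) {R \<in> orth_group k. M * R \<in> cov_mats k}"
proof -
  let ?l = "vec_space.rank k M"
  obtain U V s where U: "U \<in> orth_group k" and V: "V \<in> orth_group k" and MV: "M * V = U * mat_diag k s"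
    and l: "?l \<le> k" and pos: "\<And>i. i < ?l \<Longrightarrow> s i > 0" and z: "\<And>i. ?l \<le> i \<Longrightarrow> i < k \<Longrightarrow> s i = 0"
    using singular_value_decomposition[OF M] by metis
  define S where "S = mat_diag k s"
  have c: "V \<in> carrier_mat k k" "V\<^sup>T \<in> carrier_mat k k" "U \<in> carrier_mat k k" "U\<^sup>T \<in> carrier_mat k k" "S \<in> carrier_mat k k"
    using V U by (auto simp: orth_group_def S_def)
  note m = mult_carrier_mat[of _ k k _ k]
  have s: "s i \<ge> 0" if "i < k" for i using pos[of i] z[of i] that by (cases "i < ?l") auto
  define g where "g W = V * (W * U\<^sup>T)" for W
  have Mg: "M * g W = U * (S * W * U\<^sup>T)" if W: "W \<in> carrier_mat k k" for W
  proof -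
    have "M * g W = U * S * (W * U\<^sup>T)"
      using assoc_mult_mat[OF M c(1) m[OF W c(4)]] MV by (simp add: g_def S_def)
    also have "\<dots> = U * (S * (W * U\<^sup>T))" by (rule assoc_mult_mat[OF c(3,5) m[OF W c(4)]])
    finally show ?thesis by (simp only: assoc_mult_mat[OF c(5) W c(4)])
  qed
  have P: "U * (S * U\<^sup>T) \<in> cov_mats k"
    using conj_mat_diag_cov[OF c(3), of s] s assoc_mult_mat[OF c(3,5,4)] by (simp add: S_def)
  have fix_iff: "M * g W \<in> cov_mats k \<longleftrightarrow> S * W = S" if W: "W \<in> orth_group k" for W
  proof
    have Wc: "W \<in> carrier_mat k k" using W by (rule orth_group_carrier)
    have one: "1\<^sub>m k \<in> orth_group k" by (simp add: orth_group_def)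
    have g: "g W \<in> orth_group k" if "W \<in> orth_group k" for W
      unfolding g_def using that V U by (intro orth_group_mult orth_group_transpose)
    have P1: "M * g (1\<^sub>m k) = U * (S * U\<^sup>T)" using Mg[of "1\<^sub>m k"] c(5) by simp
    assume "M * g W \<in> cov_mats k"
    note MW = this
    have M1: "M * g (1\<^sub>m k) \<in> cov_mats k" unfolding P1 by (rule P)
    have "M * g W = M * g (1\<^sub>m k)"
      by (rule cov_mats_square_inj[OF MW M1])
        (simp only: square_eq_gram_of_cov[OF M g[OF W] MW] square_eq_gram_of_cov[OF M g[OF one] M1])
    then have "U * (S * W * U\<^sup>T) = U * (S * U\<^sup>T)" by (simp only: Mg[OF Wc] P1)
    then have "U\<^sup>T * (U * (S * W * U\<^sup>T)) = U\<^sup>T * (U * (S * U\<^sup>T))" by (simp only:)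
    then have "S * W * U\<^sup>T = S * U\<^sup>T"
      by (simp only: orth_group_cancel(2)[OF U m[OF m[OF c(5) Wc] c(4)]] orth_group_cancel(2)[OF U m[OF c(5,4)]])
    then have "S * W * U\<^sup>T * U = S * U\<^sup>T * U" by (simp only:)
    then have "S * W * (U\<^sup>T * U) = S * (U\<^sup>T * U)"
      by (simp only: assoc_mult_mat[OF m[OF c(5) Wc] c(4,3)] assoc_mult_mat[OF c(5,4,3)])
    then show "S * W = S" 
      by (simp only: orth_group_left[OF U] right_mult_one_mat[OF c(5)]
          right_mult_one_mat[OF m[OF c(5) Wc]])
  next
    assume "S * W = S"
    then show "M * g W \<in> cov_mats k" by (simp only: Mg[OF orth_group_carrier[OF W]] P)
  qed
  have gb: "bij_betw g (orth_group k) (orth_group k)"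
    using orth_group_mult_bij[OF V U] unfolding g_def .
  let ?F = "{W \<in> orth_group k. S * W = S}"
  have "g ` ?F = {R \<in> orth_group k. M * R \<in> cov_mats k}"
  proof (rule equalityI; rule subsetI)
    fix R assume "R \<in> g ` ?F"
    then obtain W where W: "W \<in> orth_group k" "S * W = S" "R = g W" by blast
    then show "R \<in> {R \<in> orth_group k. M * R \<in> cov_mats k}"
      using fix_iff[OF W(1)] bij_betwE[OF gb] by simp
  next
    fix R assume "R \<in> {R \<in> orth_group k. M * R \<in> cov_mats k}"
    then have R: "R \<in> orth_group k" "M * R \<in> cov_mats k" by auto
    then obtain W where W: "W \<in> orth_group k" "R = g W"
      using bij_betw_imp_surj_on[OF gb] by blast
    then show "R \<in> g ` ?F" using fix_iff[OF W(1)] R(2) by blast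
  qed
  moreover have "inj_on g ?F"
    by (rule inj_on_subset[OF bij_betw_imp_inj_on[OF gb]]) blast
  ultimately have "bij_betw g ?F {R \<in> orth_group k. M * R \<in> cov_mats k}"
    unfolding bij_betw_def by blast
  moreover have nz: "s i \<noteq> 0" if "i < ?l" for i using pos[OF that] by simp
  have "?F = block_embed ?l (k - ?l) ` orth_group (k - ?l)"
    unfolding S_def by (rule orth_fixing_diagonal_iff[OF l nz z])
  then have "bij_betw (block_embed ?l (k - ?l)) (orth_group (k - ?l)) ?F"
    unfolding bij_betw_def using block_embed_inj by blast
  ultimately show ?thesis by (blast intro: bij_betw_trans)
qed

section \<open>The index set of minimizing logarithms\<close>

lemma col_space_conj_invertible:
  fixes Q D :: "real mat"
  assumes Q: "Q \<in> stiefel n k" and D: "D \<in> carrier_mat k k" and E: "E \<in> carrier_mat k k" and DE: "D * E = 1\<^sub>m k"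
  shows "vec_space.col_space n (Q * D * Q\<^sup>T) = vec_space.col_space n Q"
proof -
  have c: "Q \<in> carrier_mat n k" "Q\<^sup>T \<in> carrier_mat k n" and QQ: "Q\<^sup>T * Q = 1\<^sub>m k"
    using Q by (auto simp: stiefel_def)
  have "vec_space.col_space n (Q * D * Q\<^sup>T) = vec_space.col_space n (Q * D)"
    by (rule col_space_mult_right_inverse[OF mult_carrier_mat[OF c(1) D] c(2,1) QQ])
  also have "\<dots> = vec_space.col_space n Q"
    by (rule col_space_mult_right_inverse[OF c(1) D E DE])
  finally show ?thesis .
qed

lemma rank_cong_col_space:
  fixes A B :: "real mat"
  shows "vec_space.col_space n A = vec_space.col_space n B \<Longrightarrow> vec_space.rank n A = vec_space.rank n B"
  by (simp add: vec_space.rank_def vec_space.col_space_def)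

theorem theorem3:
  fixes n k l r :: nat
    and \<Sigma>1 \<Sigma>2 Q1 Q2 D1 D2 X Y :: "real mat"
    and P1 P2 :: "real Matrix.vec set"
    and \<theta>s :: "real list"
  assumes Q1: "Q1 \<in> stiefel n k" and Q2: "Q2 \<in> stiefel n k"
    and D1: "D1 \<in> spd_mats k" and D2: "D2 \<in> spd_mats k"
    and \<Sigma>1: "\<Sigma>1 \<in> cov_rank_mats n k" "\<Sigma>1 = Q1 * D1 * Q1\<^sup>T"
    and \<Sigma>2: "\<Sigma>2 \<in> cov_rank_mats n k" "\<Sigma>2 = Q2 * D2 * Q2\<^sup>T"
    and P1: "P1 = vec_space.col_space n \<Sigma>1"
    and P2: "P2 = vec_space.col_space n \<Sigma>2"
    and X: "X = Q1 * psd_sqrt D1"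
    and Y: "Y = Q2 * psd_sqrt D2"
    and l: "l = vec_space.rank k (X\<^sup>T * Y)"
    and \<theta>s: "\<theta>s = principal_angles n k P1 P2"
    and r: "r = card {i. i < k \<and> \<theta>s ! i = pi / 2}"
  shows "(P1 = vec_space.col_space n Q1 \<and> P2 = vec_space.col_space n Q2 \<and>
          \<Sigma>1 = X * X\<^sup>T \<and> \<Sigma>2 = Y * Y\<^sup>T) \<and>
         int k - int l = int r \<and>
         I_BW X Y = {R \<in> orth_group k. X\<^sup>T * Y * R = psd_sqrt (X\<^sup>T * \<Sigma>2 * X)} \<and>
         (\<exists>f. bij_betw f (orth_group r) (I_BW X Y))"
proof -
  have Qc: "Q1 \<in> carrier_mat n k" "Q1\<^sup>T \<in> carrier_mat k n" "Q2 \<in> carrier_mat n k" "Q2\<^sup>T \<in> carrier_mat k n"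
    using Q1 Q2 by (auto simp: stiefel_def)
  have sqrt_props: "S \<in> carrier_mat k k \<and> S\<^sup>T = S \<and> S * S = D" if "D \<in> spd_mats k" "S = psd_sqrt D" for D S
    using psd_sqrt[of D k] that spd_mats_subset_cov_mats by (auto simp: cov_mats_def)
  define S1 S2 where "S1 = psd_sqrt D1" and "S2 = psd_sqrt D2"
  note S1 = sqrt_props[OF D1 S1_def] and S2 = sqrt_props[OF D2 S2_def]
  obtain T1 where T1: "T1 \<in> carrier_mat k k" "T1 * S1 = 1\<^sub>m k" "S1 * T1 = 1\<^sub>m k"
    using spd_mats_psd_sqrt_inverse[OF D1] unfolding S1_def by metis
  obtain T2 where T2: "T2 \<in> carrier_mat k k" "T2 * S2 = 1\<^sub>m k" "S2 * T2 = 1\<^sub>m k"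
    using spd_mats_psd_sqrt_inverse[OF D2] unfolding S2_def by metis
  have factor: "Q * D * Q\<^sup>T = Q * S * (Q * S)\<^sup>T \<and>
      vec_space.col_space n (Q * D * Q\<^sup>T) = vec_space.col_space n Q"
    if Q: "Q \<in> stiefel n k" and S: "S \<in> carrier_mat k k \<and> S\<^sup>T = S \<and> S * S = D"
      and T: "T \<in> carrier_mat k k" "S * T = 1\<^sub>m k" for Q S T D
  proof
    have c: "Q \<in> carrier_mat n k" "Q\<^sup>T \<in> carrier_mat k n" "S \<in> carrier_mat k k" "D \<in> carrier_mat k k"
      using Q S by (auto simp: stiefel_def)
    have "Q * D * Q\<^sup>T = Q * S * S * Q\<^sup>T" using S assoc_mult_mat[OF c(1,3,3)] by simp
    also have "\<dots> = Q * S * (S * Q\<^sup>T)" by (rule assoc_mult_mat[OF mult_carrier_mat[OF c(1,3)] c(3,2)])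
    also have "S * Q\<^sup>T = (Q * S)\<^sup>T" using transpose_mult[OF c(1,3)] S by simp
    finally show "Q * D * Q\<^sup>T = Q * S * (Q * S)\<^sup>T" .
    \<comment> \<open>\<open>D = S\<^sup>2\<close> is inverted by \<open>T\<^sup>2\<close>.\<close>
    have "D * (T * T) = S * (S * T * T)"
      using S T c assoc_mult_mat[OF c(3,3) mult_carrier_mat[OF T(1,1)]] assoc_mult_mat[OF c(3) T(1,1)] by simp
    then have "D * (T * T) = 1\<^sub>m k" using T by simp
    then show "vec_space.col_space n (Q * D * Q\<^sup>T) = vec_space.col_space n Q"
      by (rule col_space_conj_invertible[OF Q c(4) mult_carrier_mat[OF T(1,1)]])
  qed
  note f1 = factor[OF Q1 S1 T1(1,3), folded \<Sigma>1(2) X[folded S1_def]]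
   and f2 = factor[OF Q2 S2 T2(1,3), folded \<Sigma>2(2) Y[folded S2_def]]
  have PQ: "P1 = vec_space.col_space n Q1" "P2 = vec_space.col_space n Q2" 
    unfolding P1 P2 by (rule conjunct2[OF f1], rule conjunct2[OF f2])
  have Xc: "X \<in> carrier_mat n k" "X\<^sup>T \<in> carrier_mat k n" and Yc: "Y \<in> carrier_mat n k" "Y\<^sup>T \<in> carrier_mat k n"
    using Qc S1 S2 unfolding X Y S1_def S2_def by auto
  define A M where "A = Q1\<^sup>T * Q2" and "M = X\<^sup>T * Y"
  have A: "A \<in> carrier_mat k k" and M: "M \<in> carrier_mat k k" using Qc Xc Yc by (auto simp: A_def M_def)
  have "X\<^sup>T = S1 * Q1\<^sup>T" using transpose_mult[OF Qc(1), of S1 k] S1 by (simp add: X S1_def)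
  then have "M = S1 * Q1\<^sup>T * (Q2 * S2)" by (simp add: M_def Y S2_def)
  also have "\<dots> = S1 * (A * S2)"
    unfolding A_def using S1 S2 Qc mult_carrier_mat[OF Qc(3), of S2 k]
      assoc_mult_mat[OF _ Qc(2), of S1 k "Q2 * S2" k] assoc_mult_mat[OF Qc(2,3), of S2 k] by simp
  finally have MA: "M = S1 * (A * S2)" .
  have AS: "A * S2 \<in> carrier_mat k k" using A S2 by simp
  have "vec_space.rank k M = vec_space.rank k (A * S2)"
    unfolding MA using rank_mult_left_inverse[OF AS _ T1(1,2)] S1 by simp
  also have "\<dots> = vec_space.rank k A"
    using col_space_mult_right_inverse[OF A _ T2(1,3)] S2 by (intro rank_cong_col_space) simp
  finally have rank: "l = vec_space.rank k A" using l by (simp add: M_def)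
  have lk: "l \<le> k" using gram_spectral[OF A] unfolding rank by metis
  have rl: "r = k - l"
    unfolding r \<theta>s PQ rank A_def by (rule card_right_principal_angles[OF Q1 Q2])
  have dim: "dim_col X = k" using Xc by simp
  have "M * M\<^sup>T = X\<^sup>T * Y * (Y\<^sup>T * X)"
    using transpose_mult[OF Xc(2) Yc(1)] by (simp add: M_def)
  also have "\<dots> = X\<^sup>T * (Y * (Y\<^sup>T * X))" by (rule assoc_mult_mat[OF Xc(2) Yc(1) mult_carrier_mat[OF Yc(2) Xc(1)]])
  also have "\<dots> = X\<^sup>T * (Y * Y\<^sup>T * X)" by (simp only: assoc_mult_mat[OF Yc Xc(1)])
  also have "\<dots> = X\<^sup>T * (Y * Y\<^sup>T) * X"
    by (rule assoc_mult_mat[OF Xc(2) mult_carrier_mat[OF Yc] Xc(1), symmetric])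
  finally have MM: "X\<^sup>T * \<Sigma>2 * X = M * M\<^sup>T" by (simp only: conjunct1[OF f2])
  have I: "I_BW X Y = {R \<in> orth_group k. M * R \<in> cov_mats k}" by (simp add: I_BW_def dim M_def)
  have "I_BW X Y = {R \<in> orth_group k. X\<^sup>T * Y * R = psd_sqrt (X\<^sup>T * \<Sigma>2 * X)}"
    unfolding I MM using cov_mult_orth_iff_psd_sqrt[OF M] by (auto simp: M_def)
  moreover have "\<exists>f. bij_betw f (orth_group r) (I_BW X Y)"
    unfolding I rl l M_def[symmetric] by (rule cov_mult_orth_bij[OF M])
  moreover have "int k - int l = int r" using lk rl by simp
  ultimately show ?thesis
    by (intro conjI PQ conjunct1[OF f1] conjunct1[OF f2])
qed

end
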